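(* Let $G$ be a finitely generated recursively presented group with undecidable word problem. Then the subshift $X_{\leq 1}\subset\{0,1\}^G$ is not sofic.
   Context: Let $S\subset G$ be a finite generating set closed under inverses and containing $1_G$. The word problem of $G$ is the language $\mathtt{WP}(G)$ of words in $S^*$ representing $1_G$. $G$ is recursively presented if it has a presentation $\langle S\mid R\rangle$ with $S$ finite and $R\subset S^*$ recursively enumerable. $X_{\leq 1}\subset\{0,1\}^G$ is the set of configurations $x:G\to\{0,1\}$ containing at most one occurrence of $1$, i.e. $x_g=x_h=1$ implies $g=h$. For a finite alphabet $A$, $A^G$ has the product topology and left shift action $(\sigma_g x)_h=x_{g^{-1}h}$. Put $[a]_g=\{x\in A^G:x_g=a\}$. A subset $X\subset A^G$ is a subshift of finite type (SFT) if there is a finite set $\mathcal F$ of patterns (elements $p\in A^{F_p}$ with $F_p\subset G$ finite) such that $X=\bigcap_{p\in\mathcal F,\,g\in G}\big(A^G\setminus\bigcap_{h\in F_p}[p_h]_{gh}\big)$. A subshift $Y$ (closed shift-invariant set) is sofic if there is an SFT $Z$ on $G$ (over some finite alphabet) and a continuous shift-commuting surjection $Z\to Y$. *)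

theory Defs
  imports
    "HOL-Analysis.Function_Topology"
    "HOL-Algebra.Generated_Groups"
    "HOL-Library.Nat_Bijection"
begin

section \<open>Computability\<close>

text \<open>
  \<open>recursive_fn k f\<close>: the restriction of \<open>f\<close> to lists of length \<open>k\<close> is a total recursive function
  of \<open>k\<close> arguments. Minimisation is only applied to regular functions, so all functions stay
  total; by Kleene's normal form theorem this yields all total computable functions. Values of \<open>f\<close>
  on lists of other lengths are irrelevant (last rule).
\<close>

inductive recursive_fn :: "nat \<Rightarrow> (nat list \<Rightarrow> nat) \<Rightarrow> bool" where
  zero: "recursive_fn k (\<lambda>_. 0)"
| succ: "recursive_fn 1 (\<lambda>xs. Suc (xs ! 0))"
| proj: "i < k \<Longrightarrow> recursive_fn k (\<lambda>xs. xs ! i)"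
| composition: "recursive_fn (length fs) g \<Longrightarrow> (\<forall>f\<in>set fs. recursive_fn k f) \<Longrightarrow>
    recursive_fn k (\<lambda>xs. g (map (\<lambda>f. f xs) fs))"
| recursion: "recursive_fn k f \<Longrightarrow> recursive_fn (Suc (Suc k)) g \<Longrightarrow>
    recursive_fn (Suc k) (\<lambda>xs. rec_nat (f (tl xs)) (\<lambda>y r. g (y # r # tl xs)) (hd xs))"
| minimisation: "recursive_fn (Suc k) f \<Longrightarrow> (\<forall>xs. length xs = k \<longrightarrow> (\<exists>y. f (y # xs) = 0)) \<Longrightarrow>
    recursive_fn k (\<lambda>xs. LEAST y. f (y # xs) = 0)"
| extensional: "recursive_fn k f \<Longrightarrow> (\<forall>xs. length xs = k \<longrightarrow> g xs = f xs) \<Longrightarrow> recursive_fn k g"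

definition computable :: "(nat \<Rightarrow> nat) \<Rightarrow> bool" where
  "computable f \<longleftrightarrow> recursive_fn 1 (\<lambda>xs. f (xs ! 0))"

definition decidable_set :: "nat set \<Rightarrow> bool" where
  "decidable_set M \<longleftrightarrow> computable (\<lambda>n. if n \<in> M then 1 else 0)"

definition re_set :: "nat set \<Rightarrow> bool" where
  "re_set M \<longleftrightarrow> M = {} \<or> (\<exists>f. computable f \<and> M = range f)"

text \<open>
  A language over a finite alphabet \<open>A\<close> is turned into a set of numbers by numbering the letters
  and applying the bijection \<open>list_encode :: nat list \<Rightarrow> nat\<close>. For finite \<open>A\<close> the choice of the
  numbering \<open>e\<close> is immaterial, as two numberings differ by a finite table; the two
  definitions are meant for finite \<open>A\<close> only.
\<close>

definition decidable_language :: "'c set \<Rightarrow> 'c list set \<Rightarrow> bool" where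
  "decidable_language A L \<longleftrightarrow>
    (\<exists>e. inj_on e A \<and> decidable_set ((\<lambda>w. list_encode (map e w)) ` L))"

definition re_language :: "'c set \<Rightarrow> 'c list set \<Rightarrow> bool" where
  "re_language A L \<longleftrightarrow>
    (\<exists>e. inj_on e A \<and> re_set ((\<lambda>w. list_encode (map e w)) ` L))"


section \<open>Word problem and presentations\<close>

definition word_problem :: "('a, 'm) monoid_scheme \<Rightarrow> 'a set \<Rightarrow> 'a list set" where
  "word_problem G S = {w \<in> lists S. foldr (\<lambda>s t. s \<otimes>\<^bsub>G\<^esub> t) w \<one>\<^bsub>G\<^esub> = \<one>\<^bsub>G\<^esub>}"

text \<open>
  The letter \<open>(True, a)\<close> stands for the generator \<open>a\<close> and \<open>(False, a)\<close> for its formal inverse.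
  \<open>pres_eq A R\<close> is the congruence on words generated by free cancellation and the
  relators in \<open>R\<close>, so that its quotient is the group with presentation \<open>\<langle>A | R\<rangle>\<close>.
\<close>

type_synonym 'c sletter = "bool \<times> 'c"

abbreviation sletters :: "'c set \<Rightarrow> 'c sletter set" where
  "sletters A \<equiv> UNIV \<times> A"

inductive pres_eq :: "'c set \<Rightarrow> 'c sletter list set \<Rightarrow> 'c sletter list \<Rightarrow> 'c sletter list \<Rightarrow> bool"
  for A :: "'c set" and R :: "'c sletter list set" where
  pe_refl: "w \<in> lists (sletters A) \<Longrightarrow> pres_eq A R w w"
| pe_sym: "pres_eq A R v w \<Longrightarrow> pres_eq A R w v"
| pe_trans: "pres_eq A R u v \<Longrightarrow> pres_eq A R v w \<Longrightarrow> pres_eq A R u w"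
| cancel: "u \<in> lists (sletters A) \<Longrightarrow> v \<in> lists (sletters A) \<Longrightarrow> a \<in> A \<Longrightarrow>
    pres_eq A R (u @ [(b, a), (\<not> b, a)] @ v) (u @ v)"
| relator: "u \<in> lists (sletters A) \<Longrightarrow> v \<in> lists (sletters A) \<Longrightarrow> r \<in> R \<Longrightarrow>
    pres_eq A R (u @ r @ v) (u @ v)"

definition pres_class :: "'c set \<Rightarrow> 'c sletter list set \<Rightarrow> 'c sletter list \<Rightarrow> 'c sletter list set" where
  "pres_class A R w = {v. pres_eq A R w v}"

definition presented_group :: "'c set \<Rightarrow> 'c sletter list set \<Rightarrow> 'c sletter list set monoid" where
  "presented_group A R =
    \<lparr>carrier = pres_class A R ` lists (sletters A),
     mult = (\<lambda>U V. \<Union>u\<in>U. \<Union>v\<in>V. pres_class A R (u @ v)),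
     one = pres_class A R []\<rparr>"

text \<open>Natural numbers serve as a supply of names for the generators.\<close>

definition recursively_presented :: "('a, 'm) monoid_scheme \<Rightarrow> bool" where
  "recursively_presented G \<longleftrightarrow>
    (\<exists>(A :: nat set) R. finite A \<and> R \<subseteq> lists (sletters A) \<and> re_language (sletters A) R \<and>
      presented_group A R \<cong> G)"


section \<open>Subshifts\<close>

definition full_shift :: "('a, 'm) monoid_scheme \<Rightarrow> 'c set \<Rightarrow> ('a \<Rightarrow> 'c) set" where
  "full_shift G A = carrier G \<rightarrow>\<^sub>E A"

definition shift_topology :: "('a, 'm) monoid_scheme \<Rightarrow> 'c set \<Rightarrow> ('a \<Rightarrow> 'c) topology" where
  "shift_topology G A = product_topology (\<lambda>_. discrete_topology A) (carrier G)"

definition shift :: "('a, 'm) monoid_scheme \<Rightarrow> 'a \<Rightarrow> ('a \<Rightarrow> 'c) \<Rightarrow> 'a \<Rightarrow> 'c" where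
  "shift G g x = (\<lambda>h\<in>carrier G. x (inv\<^bsub>G\<^esub> g \<otimes>\<^bsub>G\<^esub> h))"

definition cylinder :: "('a, 'm) monoid_scheme \<Rightarrow> 'c set \<Rightarrow> 'a \<Rightarrow> 'c \<Rightarrow> ('a \<Rightarrow> 'c) set" where
  "cylinder G A g a = {x \<in> full_shift G A. x g = a}"

text \<open>A pattern is a pair of its finite support and a function on the support.\<close>

definition patterns :: "('a, 'm) monoid_scheme \<Rightarrow> 'c set \<Rightarrow> ('a set \<times> ('a \<Rightarrow> 'c)) set" where
  "patterns G A = {(F, p). finite F \<and> F \<subseteq> carrier G \<and> p \<in> F \<rightarrow>\<^sub>E A}"

definition subshift :: "('a, 'm) monoid_scheme \<Rightarrow> 'c set \<Rightarrow> ('a \<Rightarrow> 'c) set \<Rightarrow> bool" where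
  "subshift G A X \<longleftrightarrow> closedin (shift_topology G A) X \<and>
    (\<forall>g\<in>carrier G. \<forall>x\<in>X. shift G g x \<in> X)"

definition SFT :: "('a, 'm) monoid_scheme \<Rightarrow> 'c set \<Rightarrow> ('a \<Rightarrow> 'c) set \<Rightarrow> bool" where
  "SFT G A X \<longleftrightarrow> (\<exists>P. finite P \<and> P \<subseteq> patterns G A \<and>
    X = full_shift G A \<inter>
      (\<Inter>(F, p)\<in>P. \<Inter>g\<in>carrier G.
        full_shift G A - (\<Inter>h\<in>F. cylinder G A (g \<otimes>\<^bsub>G\<^esub> h) (p h))))"

text \<open>The alphabet \<open>B\<close> of the SFT ranges over finite sets of natural numbers, which up to renaming
  are all finite alphabets.\<close>

definition sofic :: "('a, 'm) monoid_scheme \<Rightarrow> 'c set \<Rightarrow> ('a \<Rightarrow> 'c) set \<Rightarrow> bool" where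
  "sofic G A Y \<longleftrightarrow> subshift G A Y \<and>
    (\<exists>(B :: nat set) Z \<phi>. finite B \<and> SFT G B Z \<and>
      continuous_map (subtopology (shift_topology G B) Z) (subtopology (shift_topology G A) Y) \<phi> \<and>
      (\<forall>g\<in>carrier G. \<forall>z\<in>Z. \<phi> (shift G g z) = shift G g (\<phi> z)) \<and>
      \<phi> ` Z = Y)"

definition X_le1 :: "('a, 'm) monoid_scheme \<Rightarrow> ('a \<Rightarrow> nat) set" where
  "X_le1 G = {x \<in> full_shift G {0, 1}.
    \<forall>g\<in>carrier G. \<forall>h\<in>carrier G. x g = 1 \<and> x h = 1 \<longrightarrow> g = h}"


section \<open>Well-definedness of the notions above\<close>

lemma pres_eq_lists:
  assumes "pres_eq A R v w" "R \<subseteq> lists (sletters A)"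
  shows "v \<in> lists (sletters A) \<and> w \<in> lists (sletters A)"
  using assms by (induction) auto

lemma pres_eq_append_left:
  assumes "pres_eq A R v w" "u \<in> lists (sletters A)"
  shows "pres_eq A R (u @ v) (u @ w)"
  using assms
proof (induction)
  case (cancel x y a b)
  then have "pres_eq A R ((u @ x) @ [(b, a), (\<not> b, a)] @ y) ((u @ x) @ y)"
    by (intro pres_eq.cancel) auto
  then show ?case by simp
next
  case (relator x y r)
  then have "pres_eq A R ((u @ x) @ r @ y) ((u @ x) @ y)"
    by (intro pres_eq.relator) auto
  then show ?case by simp
next
  case (pe_refl w)
  then show ?case by (simp add: pres_eq.pe_refl)
next
  case (pe_sym v w)
  from pres_eq.pe_sym[OF pe_sym.IH[OF pe_sym.prems]] show ?case .
next
  case (pe_trans v x w)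
  from pres_eq.pe_trans[OF pe_trans.IH(1)[OF pe_trans.prems] pe_trans.IH(2)[OF pe_trans.prems]]
  show ?case .
qed

lemma pres_eq_append_right:
  assumes "pres_eq A R v w" "u \<in> lists (sletters A)"
  shows "pres_eq A R (v @ u) (w @ u)"
  using assms
proof (induction)
  case (cancel x y a b)
  then have "pres_eq A R (x @ [(b, a), (\<not> b, a)] @ (y @ u)) (x @ (y @ u))"
    by (intro pres_eq.cancel) auto
  then show ?case by simp
next
  case (relator x y r)
  then have "pres_eq A R (x @ r @ (y @ u)) (x @ (y @ u))"
    by (intro pres_eq.relator) auto
  then show ?case by simp
next
  case (pe_refl w)
  then show ?case by (simp add: pres_eq.pe_refl)
next
  case (pe_sym v w)
  from pres_eq.pe_sym[OF pe_sym.IH[OF pe_sym.prems]] show ?case .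
next
  case (pe_trans v x w)
  from pres_eq.pe_trans[OF pe_trans.IH(1)[OF pe_trans.prems] pe_trans.IH(2)[OF pe_trans.prems]]
  show ?case .
qed

lemma pres_class_eq:
  assumes "pres_eq A R v w"
  shows "pres_class A R v = pres_class A R w"
  unfolding pres_class_def
  using pres_eq.pe_trans[OF assms] pres_eq.pe_trans[OF pres_eq.pe_sym[OF assms]] by blast

lemma presented_group_mult:
  assumes R: "R \<subseteq> lists (sletters A)"
    and u: "u \<in> lists (sletters A)" and v: "v \<in> lists (sletters A)"
  shows "pres_class A R u \<otimes>\<^bsub>presented_group A R\<^esub> pres_class A R v = pres_class A R (u @ v)"
proof -
  have "pres_class A R (u' @ v') = pres_class A R (u @ v)"
    if "u' \<in> pres_class A R u" "v' \<in> pres_class A R v" for u' v'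
  proof -
    have uu: "pres_eq A R u u'" and vv: "pres_eq A R v v'"
      using that by (auto simp: pres_class_def)
    have "pres_eq A R (u @ v) (u' @ v)" using uu v by (rule pres_eq_append_right)
    moreover have "pres_eq A R (u' @ v) (u' @ v')"
      using vv pres_eq_lists[OF uu R] by (blast intro: pres_eq_append_left)
    ultimately have "pres_eq A R (u @ v) (u' @ v')" by (rule pres_eq.pe_trans)
    then show ?thesis by (rule pres_class_eq[symmetric])
  qed
  then have "(\<Union>u'\<in>pres_class A R u. \<Union>v'\<in>pres_class A R v. pres_class A R (u' @ v')) =
      (\<Union>u'\<in>pres_class A R u. \<Union>v'\<in>pres_class A R v. pres_class A R (u @ v))"
    by (intro SUP_cong refl)
  moreover have "u \<in> pres_class A R u" "v \<in> pres_class A R v"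
    using u v by (auto simp: pres_class_def intro: pres_eq.pe_refl)
  then have "pres_class A R u \<noteq> {}" "pres_class A R v \<noteq> {}" by blast+
  ultimately show ?thesis by (simp add: presented_group_def)
qed

lemma pres_eq_inverse:
  assumes "w \<in> lists (sletters A)"
  shows "pres_eq A R (map (\<lambda>(b, a). (\<not> b, a)) (rev w) @ w) []"
  using assms
proof (induction w)
  case Nil
  then show ?case by (simp add: pres_eq.pe_refl)
next
  case (Cons l w)
  obtain b a where l: "l = (b, a)" by (cases l)
  let ?i = "map (\<lambda>(b, a). (\<not> b, a)) (rev w)"
  have "?i \<in> lists (sletters A)" using Cons by auto
  then have "pres_eq A R (?i @ [(\<not> b, a), (\<not> \<not> b, a)] @ w) (?i @ w)"
    using Cons l by (intro pres_eq.cancel) auto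
  moreover have "pres_eq A R (?i @ w) []" using Cons by auto
  ultimately have "pres_eq A R (?i @ [(\<not> b, a), (\<not> \<not> b, a)] @ w) []"
    by (rule pres_eq.pe_trans)
  then show ?case using l by simp
qed

lemma group_presented_group:
  assumes R: "R \<subseteq> lists (sletters A)"
  shows "group (presented_group A R)"
proof (rule groupI)
  let ?P = "presented_group A R"
  have carr: "carrier ?P = pres_class A R ` lists (sletters A)"
    and one: "\<one>\<^bsub>?P\<^esub> = pres_class A R []"
    by (simp_all add: presented_group_def)
  have memE: "\<exists>w\<in>lists (sletters A). x = pres_class A R w" if "x \<in> carrier ?P" for x
    using that unfolding carr by blast
  have memI: "pres_class A R w \<in> carrier ?P" if "w \<in> lists (sletters A)" for w
    using that unfolding carr by blast
  note mult = presented_group_mult[OF R]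
  show "x \<otimes>\<^bsub>?P\<^esub> y \<in> carrier ?P" if xy: "x \<in> carrier ?P" "y \<in> carrier ?P" for x y
  proof -
    obtain u v where "u \<in> lists (sletters A)" "v \<in> lists (sletters A)"
      "x = pres_class A R u" "y = pres_class A R v"
      using memE[OF xy(1)] memE[OF xy(2)] by blast
    then show ?thesis using memI[of "u @ v"] mult[of u v] by simp
  qed
  show "\<one>\<^bsub>?P\<^esub> \<in> carrier ?P" unfolding one by (rule memI) simp
  show "x \<otimes>\<^bsub>?P\<^esub> y \<otimes>\<^bsub>?P\<^esub> z = x \<otimes>\<^bsub>?P\<^esub> (y \<otimes>\<^bsub>?P\<^esub> z)"
    if xyz: "x \<in> carrier ?P" "y \<in> carrier ?P" "z \<in> carrier ?P" for x y z
  proof -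
    obtain u v w where "u \<in> lists (sletters A)" "v \<in> lists (sletters A)" "w \<in> lists (sletters A)"
      "x = pres_class A R u" "y = pres_class A R v" "z = pres_class A R w"
      using memE[OF xyz(1)] memE[OF xyz(2)] memE[OF xyz(3)] by blast
    then show ?thesis
      using mult[of u v] mult[of v w] mult[of "u @ v" w] mult[of u "v @ w"] by simp
  qed
  show "\<one>\<^bsub>?P\<^esub> \<otimes>\<^bsub>?P\<^esub> x = x" if x: "x \<in> carrier ?P" for x
  proof -
    obtain w where "w \<in> lists (sletters A)" "x = pres_class A R w"
      using memE[OF x] by blast
    then show ?thesis using mult[of "[]" w] one by simp
  qed
  show "\<exists>y\<in>carrier ?P. y \<otimes>\<^bsub>?P\<^esub> x = \<one>\<^bsub>?P\<^esub>" if x: "x \<in> carrier ?P" for x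
  proof -
    obtain w where w: "w \<in> lists (sletters A)" and xw: "x = pres_class A R w"
      using memE[OF x] by blast
    define i where "i = map (\<lambda>(b, a). (\<not> b, a)) (rev w)"
    have i: "i \<in> lists (sletters A)" using w by (auto simp: i_def)
    have "pres_class A R i \<otimes>\<^bsub>?P\<^esub> x = pres_class A R (i @ w)"
      unfolding xw using i w by (rule mult)
    also have "\<dots> = \<one>\<^bsub>?P\<^esub>"
      unfolding one i_def using pres_eq_inverse[OF w] by (rule pres_class_eq)
    finally show ?thesis using memI[OF i] by (rule bexI)
  qed
qed

lemma subshift_X_le1:
  assumes "group G"
  shows "subshift G {0, 1} (X_le1 G)"
  unfolding subshift_def
proof (intro conjI ballI)
  interpret group G by fact
  let ?T = "shift_topology G {0, 1 :: nat}"
  let ?Z = "\<lambda>g. {x \<in> topspace ?T. x g \<in> {0}}"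
  have top: "topspace ?T = full_shift G {0, 1}"
    by (simp add: shift_topology_def full_shift_def)
  have "closedin ?T (?Z g)" if "g \<in> carrier G" for g
  proof (rule closedin_continuous_map_preimage)
    show "continuous_map ?T (discrete_topology {0, 1}) (\<lambda>x. x g)"
      unfolding shift_topology_def using that by (rule continuous_map_product_projection)
  qed auto
  then have "closedin ?T (\<Inter>(insert (topspace ?T)
      {?Z g \<union> ?Z h | g h. g \<in> carrier G \<and> h \<in> carrier G \<and> g \<noteq> h}))"
    by (intro closedin_Inter) (blast intro: closedin_Un closedin_topspace)+
  also have "\<Inter>(insert (topspace ?T)
      {?Z g \<union> ?Z h | g h. g \<in> carrier G \<and> h \<in> carrier G \<and> g \<noteq> h}) = X_le1 G" (is "?L = _")
  proof
    show "?L \<subseteq> X_le1 G"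
    proof
      fix x assume x: "x \<in> ?L"
      have "g = h" if "g \<in> carrier G" "h \<in> carrier G" "x g = 1" "x h = 1" for g h
      proof (rule ccontr)
        assume "g \<noteq> h"
        then have "x \<in> ?Z g \<union> ?Z h" using x that by blast
        then show False using that by auto
      qed
      then show "x \<in> X_le1 G" using x top by (auto simp: X_le1_def)
    qed
    have "x g = 0 \<or> x h = 0"
      if "x \<in> X_le1 G" "g \<in> carrier G" "h \<in> carrier G" "g \<noteq> h" for x g h
    proof -
      have "x g \<in> {0, 1}" "x h \<in> {0, 1}"
        using that by (auto simp: X_le1_def full_shift_def)
      then show ?thesis using that by (auto simp: X_le1_def)
    qed
    moreover have "X_le1 G \<subseteq> topspace ?T" unfolding top X_le1_def by blast
    ultimately show "X_le1 G \<subseteq> ?L" by blast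
  qed
  finally show "closedin ?T (X_le1 G)" .
  fix g x assume g: "g \<in> carrier G" and x: "x \<in> X_le1 G"
  have "shift G g x \<in> full_shift G {0, 1}"
    using g x by (auto simp: X_le1_def shift_def full_shift_def PiE_iff)
  moreover have "h = k"
    if hk: "h \<in> carrier G" "k \<in> carrier G" "shift G g x h = 1" "shift G g x k = 1" for h k
  proof -
    have "inv\<^bsub>G\<^esub> g \<otimes>\<^bsub>G\<^esub> h = inv\<^bsub>G\<^esub> g \<otimes>\<^bsub>G\<^esub> k"
      using g x hk by (simp add: X_le1_def shift_def)
    then show ?thesis using g hk by simp
  qed
  ultimately show "shift G g x \<in> X_le1 G"
    by (simp add: X_le1_def)
qed

end

theory Submission
  imports Defs
begin

text \<open>
  A sofic cover of \<open>X_le1 G\<close> would give an algorithm for the word problem. In a recursively presented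
  group the trivial words are recursively enumerable, so by Post's theorem (\<open>decidable_setI\<close>) it is
  enough that the nontrivial words are semidecidable as well.

  Suppose that \<open>\<phi>\<close> maps an SFT \<open>Z\<close> onto the configurations with at most one 1. By continuity there is a finite
  pattern \<open>q\<close>, occurring in \<open>Z\<close>, which forces the image to have a 1 at the place where \<open>q\<close> occurs. Hence
  no element of \<open>Z\<close> shows \<open>q\<close> at two different places (\<open>sofic_X_le1_marker\<close>), and a word \<open>w\<close> is
  nontrivial iff no element of \<open>Z\<close> shows \<open>q\<close> both at the neutral element and at \<open>w\<close>. This emptiness has
  finite certificates. Colour words instead of group elements, and require that words already recognised
  as equal get equal colours, that no forbidden pattern occurs, and that \<open>q\<close> is shown at the
  two places. By compactness there is no admissible colouring iff, for some \<open>N\<close>, each of the finitely many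
  colourings of the first \<open>N\<close> words has a conflict (\<open>refuted_iff_nontrivial\<close>). Conflicts are semidecidable because
  equality of words is (\<open>semidecidable_thue\<close>), so the existence of such an \<open>N\<close> is semidecidable too.

  To turn these enumeration procedures into formal statements about \<open>recursive_fn\<close>, semidecidable predicates
  are shown to be closed under conjunction, disjunction, existential and bounded universal
  quantification, and under passing to the reflexive transitive closure of a relation
  (\<open>semidecidable_rtranclp\<close>). The last of these covers every recursion on coded words, such as
  concatenation and the congruence generated by rewriting rules.
\<close>

section \<open>Closure properties of recursive functions\<close>

text \<open>
  Recursive maps between tuples are the substitutions of this calculus: a recursive function may be
  precomposed with them. With \<open>hd\<close> read as the most recently bound variable and \<open>tl\<close> as the
  weakening of a context, the closure lemmas below can be applied as introduction rules to
  expressions with bound variables, without explicit projections.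
\<close>

definition recursive_map :: "nat \<Rightarrow> nat \<Rightarrow> (nat list \<Rightarrow> nat list) \<Rightarrow> bool" where
  "recursive_map m k \<rho> \<longleftrightarrow> (\<exists>fs. length fs = k \<and> (\<forall>f\<in>set fs. recursive_fn m f) \<and>
     (\<forall>xs. length xs = m \<longrightarrow> \<rho> xs = map (\<lambda>f. f xs) fs))"

lemma recursive_fn_map:
  assumes "recursive_fn k f" "recursive_map m k \<rho>"
  shows "recursive_fn m (\<lambda>xs. f (\<rho> xs))"
proof -
  obtain fs where fs: "length fs = k" "\<forall>f\<in>set fs. recursive_fn m f"
     "\<forall>xs. length xs = m \<longrightarrow> \<rho> xs = map (\<lambda>f. f xs) fs"
    using assms(2) unfolding recursive_map_def by blast
  have "recursive_fn m (\<lambda>xs. f (map (\<lambda>f. f xs) fs))"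
    using fs assms(1) by (intro composition) auto
  then show ?thesis using fs(3) by (rule_tac extensional) auto
qed

lemma recursive_map_Nil: "recursive_map m 0 (\<lambda>xs. [])"
  unfolding recursive_map_def by (intro exI[of _ "[]"]) auto

lemma recursive_map_Cons:
  assumes "recursive_fn m t" "recursive_map m k \<rho>"
  shows "recursive_map m (Suc k) (\<lambda>xs. t xs # \<rho> xs)"
proof -
  obtain fs where fs: "length fs = k" "\<forall>f\<in>set fs. recursive_fn m f"
     "\<forall>xs. length xs = m \<longrightarrow> \<rho> xs = map (\<lambda>f. f xs) fs"
    using assms(2) unfolding recursive_map_def by blast
  then show ?thesis unfolding recursive_map_def using assms(1)
    by (intro exI[of _ "t # fs"]) auto
qed

lemma recursive_map_id: "recursive_map k k (\<lambda>xs. xs)"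
  unfolding recursive_map_def
  by (intro exI[of _ "map (\<lambda>i xs. xs ! i) [0..<k]"]) (auto intro: proj nth_equalityI)

lemma recursive_map_tl: "recursive_map (Suc k) k tl"
  unfolding recursive_map_def
  by (intro exI[of _ "map (\<lambda>i xs. xs ! Suc i) [0..<k]"]) (auto intro: proj nth_equalityI simp: nth_tl)

lemma recursive_map_comp:
  assumes "recursive_map m k \<rho>" "recursive_map l m \<sigma>"
  shows "recursive_map l k (\<lambda>xs. \<rho> (\<sigma> xs))"
proof -
  obtain fs where fs: "length fs = k" "\<forall>f\<in>set fs. recursive_fn m f"
     "\<forall>xs. length xs = m \<longrightarrow> \<rho> xs = map (\<lambda>f. f xs) fs"
    using assms(1) unfolding recursive_map_def by blast
  have len: "length (\<sigma> xs) = m" if "length xs = l" for xs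
    using assms(2) that unfolding recursive_map_def by auto
  show ?thesis unfolding recursive_map_def using fs len
    by (intro exI[of _ "map (\<lambda>f xs. f (\<sigma> xs)) fs"])
       (auto intro: recursive_fn_map[OF _ assms(2)])
qed

lemma recursive_fn_hd: "recursive_fn (Suc k) hd"
  by (rule extensional[OF proj[of 0]]) (auto simp: hd_conv_nth length_Suc_conv)

lemma recursive_fn_tl: "recursive_fn k f \<Longrightarrow> recursive_fn (Suc k) (\<lambda>xs. f (tl xs))"
  by (rule recursive_fn_map[OF _ recursive_map_tl])

lemma recursive_fn_subst1:
  assumes "recursive_fn (Suc 0) (\<lambda>xs. F (hd xs))" "recursive_fn k s"
  shows "recursive_fn k (\<lambda>xs. F (s xs))"
  using recursive_fn_map[OF assms(1) recursive_map_Cons[OF assms(2) recursive_map_Nil]] by simp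

lemma recursive_fn_Suc: "recursive_fn k s \<Longrightarrow> recursive_fn k (\<lambda>xs. Suc (s xs))"
  by (rule recursive_fn_subst1[OF extensional[OF succ[unfolded One_nat_def]]])
     (auto simp: hd_conv_nth length_Suc_conv)

lemma recursive_fn_const: "recursive_fn k (\<lambda>xs. c)"
  by (induction c) (auto intro: zero recursive_fn_Suc)

lemma recursive_fn_rec_nat:
  assumes t: "recursive_fn k t" and f: "recursive_fn k f"
    and g: "recursive_fn (Suc (Suc k)) (\<lambda>xs. g (hd xs) (hd (tl xs)) (tl (tl xs)))"
  shows "recursive_fn k (\<lambda>xs. rec_nat (f xs) (\<lambda>y r. g y r xs) (t xs))"
  using recursive_fn_map[OF recursion[OF f g] recursive_map_Cons[OF t recursive_map_id]] by simp

lemmas recursive_intros_base =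
  recursive_fn_const recursive_fn_Suc recursive_fn_hd recursive_fn_tl

lemma recursive_fn_add:
  assumes "recursive_fn k s" "recursive_fn k t"
  shows "recursive_fn k (\<lambda>xs. s xs + t xs)"
proof -
  have "rec_nat a (\<lambda>y. Suc) b = a + b" for a b :: nat by (induction b) auto
  then show ?thesis
    using recursive_fn_rec_nat[of k t s "\<lambda>y r xs. Suc r"] assms
    by (simp add: recursive_intros_base)
qed

lemma recursive_fn_mult:
  assumes "recursive_fn k s" "recursive_fn k t"
  shows "recursive_fn k (\<lambda>xs. s xs * t xs)"
proof -
  have "rec_nat 0 (\<lambda>y r. r + a) b = a * b" for a b :: nat by (induction b) auto
  then show ?thesis
    using recursive_fn_rec_nat[of k t "\<lambda>xs. 0" "\<lambda>y r xs. r + s xs"] assms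
    by (force intro: recursive_intros_base recursive_fn_add)
qed

lemma recursive_fn_power:
  assumes "recursive_fn k s" "recursive_fn k t"
  shows "recursive_fn k (\<lambda>xs. s xs ^ t xs)"
proof -
  have "rec_nat (Suc 0) (\<lambda>y r. r * a) b = a ^ b" for a b :: nat by (induction b) auto
  then show ?thesis
    using recursive_fn_rec_nat[of k t "\<lambda>xs. Suc 0" "\<lambda>y r xs. r * s xs"] assms
    by (force intro: recursive_intros_base recursive_fn_mult)
qed

lemma recursive_fn_pred:
  assumes "recursive_fn k s"
  shows "recursive_fn k (\<lambda>xs. s xs - Suc 0)"
proof -
  have "rec_nat 0 (\<lambda>y r. y) b = b - Suc 0" for b :: nat by (induction b) auto
  then show ?thesis
    using recursive_fn_rec_nat[of k s "\<lambda>xs. 0" "\<lambda>y r xs. y"] assms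
    by (simp add: recursive_intros_base)
qed

lemma recursive_fn_diff:
  assumes "recursive_fn k s" "recursive_fn k t"
  shows "recursive_fn k (\<lambda>xs. s xs - t xs)"
proof -
  have "rec_nat a (\<lambda>y r. r - Suc 0) b = a - b" for a b :: nat by (induction b) auto
  then show ?thesis
    using recursive_fn_rec_nat[of k t s "\<lambda>y r xs. r - Suc 0"] assms
    by (simp add: recursive_intros_base recursive_fn_pred)
qed

lemma recursive_fn_sum:
  assumes "recursive_fn k t" "recursive_fn (Suc k) (\<lambda>xs. F (hd xs) (tl xs))"
  shows "recursive_fn k (\<lambda>xs. \<Sum>i<t xs. F i xs)"
proof -
  have *: "rec_nat 0 (\<lambda>y r. r + F y xs) b = (\<Sum>i<b. F i xs)" for b xs
    by (induction b) auto
  have "recursive_fn (Suc (Suc k)) (\<lambda>xs. F (hd xs) (tl (tl xs)))"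
    using recursive_fn_map[OF assms(2) recursive_map_Cons[OF recursive_fn_hd
      recursive_map_comp[OF recursive_map_tl recursive_map_tl]]] by simp
  then show ?thesis
    using recursive_fn_rec_nat[of k t "\<lambda>xs. 0" "\<lambda>y r xs. r + F y xs"] assms(1)
    by (simp add: * recursive_intros_base recursive_fn_add)
qed

lemma recursive_fn_prod:
  assumes "recursive_fn k t" "recursive_fn (Suc k) (\<lambda>xs. F (hd xs) (tl xs))"
  shows "recursive_fn k (\<lambda>xs. \<Prod>i<t xs. F i xs)"
proof -
  have *: "rec_nat (Suc 0) (\<lambda>y r. r * F y xs) b = (\<Prod>i<b. F i xs)" for b xs
    by (induction b) auto
  have "recursive_fn (Suc (Suc k)) (\<lambda>xs. F (hd xs) (tl (tl xs)))"
    using recursive_fn_map[OF assms(2) recursive_map_Cons[OF recursive_fn_hd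
      recursive_map_comp[OF recursive_map_tl recursive_map_tl]]] by simp
  then show ?thesis
    using recursive_fn_rec_nat[of k t "\<lambda>xs. Suc 0" "\<lambda>y r xs. r * F y xs"] assms(1)
    by (simp add: * recursive_intros_base recursive_fn_mult)
qed

section \<open>Semidecidable predicates\<close>

text \<open>
  Projections of recursive zero sets, that is, \<open>\<Sigma>\<^sub>1\<close> predicates.
\<close>

definition semidecidable :: "nat \<Rightarrow> (nat list \<Rightarrow> bool) \<Rightarrow> bool" where
  "semidecidable k P \<longleftrightarrow> (\<exists>f. recursive_fn (Suc k) f \<and>
     (\<forall>xs. length xs = k \<longrightarrow> (P xs \<longleftrightarrow> (\<exists>y. f (y # xs) = 0))))"

lemma semidecidableI:
  assumes "recursive_fn (Suc k) (\<lambda>xs. f (hd xs) (tl xs))"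
    "\<And>xs. length xs = k \<Longrightarrow> P xs \<longleftrightarrow> (\<exists>y. f y xs = 0)"
  shows "semidecidable k P"
  unfolding semidecidable_def using assms by (intro exI[of _ "\<lambda>xs. f (hd xs) (tl xs)"]) auto

text \<open>
  Replacing \<open>g y\<close> by the product of all \<open>g i\<close> with \<open>i \<le> y\<close> makes the set of witnesses upward
  closed. Witnesses for several predicates then have a common bound, so that conjunctions and
  quantifiers can be treated without a pairing function.
\<close>

lemma semidecidable_mono_witness:
  assumes "semidecidable k P"
  shows "\<exists>f. recursive_fn (Suc k) (\<lambda>xs. f (hd xs) (tl xs)) \<and>
    (\<forall>xs. length xs = k \<longrightarrow> (P xs \<longleftrightarrow> (\<exists>y. f y xs = 0))) \<and>
    (\<forall>xs y z. f y xs = (0::nat) \<longrightarrow> y \<le> z \<longrightarrow> f z xs = 0)"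
proof -
  obtain g where g: "recursive_fn (Suc k) g"
    and P: "\<And>xs. length xs = k \<Longrightarrow> P xs \<longleftrightarrow> (\<exists>y. g (y # xs) = 0)"
    using assms unfolding semidecidable_def by blast
  define f where "f = (\<lambda>y xs. \<Prod>i<Suc y. g (i # xs))"
  have "recursive_fn (Suc (Suc k)) (\<lambda>xs. g (hd xs # tl (tl xs)))"
    by (rule recursive_fn_map[OF g] recursive_map_Cons recursive_fn_hd
      recursive_map_comp[OF recursive_map_tl recursive_map_tl])+
  then have "recursive_fn (Suc k) (\<lambda>xs. f (hd xs) (tl xs))"
    unfolding f_def by (intro recursive_fn_prod recursive_intros_base)
  moreover have f0: "f y xs = 0 \<longleftrightarrow> (\<exists>i\<le>y. g (i # xs) = 0)" for y xs
    unfolding f_def by (auto simp del: prod.lessThan_Suc simp: less_Suc_eq_le)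
  have "f z xs = 0" if "f y xs = 0" "y \<le> z" for y z xs
    using that unfolding f0 by (meson le_trans)
  moreover have "P xs \<longleftrightarrow> (\<exists>y. f y xs = 0)" if "length xs = k" for xs
    using P[OF that] unfolding f0 by auto
  ultimately show ?thesis by (intro exI[of _ f]) auto
qed

lemma semidecidable_subst:
  assumes "semidecidable k P" "recursive_map m k \<rho>"
  shows "semidecidable m (\<lambda>xs. P (\<rho> xs))"
proof -
  obtain f where f: "recursive_fn (Suc k) f"
    and P: "\<And>xs. length xs = k \<Longrightarrow> P xs \<longleftrightarrow> (\<exists>y. f (y # xs) = 0)"
    using assms(1) unfolding semidecidable_def by blast
  have len: "length (\<rho> xs) = k" if "length xs = m" for xs
    using assms(2) that unfolding recursive_map_def by auto
  have "recursive_fn (Suc m) (\<lambda>xs. f (hd xs # \<rho> (tl xs)))"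
    by (rule recursive_fn_map[OF f] recursive_map_Cons recursive_fn_hd
      recursive_map_comp[OF assms(2)] recursive_map_tl)+
  then show ?thesis using P len by (intro semidecidableI[of m "\<lambda>y xs. f (y # \<rho> xs)"]) auto
qed

lemma semidecidable_eq:
  assumes "recursive_fn k s" "recursive_fn k t"
  shows "semidecidable k (\<lambda>xs. s xs = t xs)"
  by (rule semidecidableI[of k "\<lambda>y xs. (s xs - t xs) + (t xs - s xs)"])
     (auto intro!: recursive_fn_add recursive_fn_diff recursive_fn_tl assms)

lemma semidecidable_conj:
  assumes "semidecidable k P" "semidecidable k Q"
  shows "semidecidable k (\<lambda>xs. P xs \<and> Q xs)"
proof -
  obtain f where f: "recursive_fn (Suc k) (\<lambda>xs. f (hd xs) (tl xs))"
    "\<forall>xs. length xs = k \<longrightarrow> (P xs \<longleftrightarrow> (\<exists>y. f y xs = 0))"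
    "\<forall>xs y z. f y xs = (0::nat) \<longrightarrow> y \<le> z \<longrightarrow> f z xs = 0"
    using semidecidable_mono_witness[OF assms(1)] by (elim exE conjE)
  note f = f[rule_format]
  obtain g where g: "recursive_fn (Suc k) (\<lambda>xs. g (hd xs) (tl xs))"
    "\<forall>xs. length xs = k \<longrightarrow> (Q xs \<longleftrightarrow> (\<exists>y. g y xs = 0))"
    "\<forall>xs y z. g y xs = (0::nat) \<longrightarrow> y \<le> z \<longrightarrow> g z xs = 0"
    using semidecidable_mono_witness[OF assms(2)] by (elim exE conjE)
  note g = g[rule_format]
  show ?thesis
  proof (rule semidecidableI[of k "\<lambda>y xs. f y xs + g y xs"])
    show "recursive_fn (Suc k) (\<lambda>xs. f (hd xs) (tl xs) + g (hd xs) (tl xs))"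
      using f(1) g(1) by (rule recursive_fn_add)
    fix xs :: "nat list" assume "length xs = k"
    moreover have "\<exists>y. f y xs = 0 \<and> g y xs = 0" if "f y xs = 0" "g z xs = 0" for y z
      using f(3)[OF that(1) max.cobounded1[of y z]] g(3)[OF that(2) max.cobounded2[of z y]]
      by blast
    ultimately show "P xs \<and> Q xs \<longleftrightarrow> (\<exists>y. f y xs + g y xs = 0)" using f(2) g(2) by auto
  qed
qed

lemma semidecidable_disj:
  assumes "semidecidable k P" "semidecidable k Q"
  shows "semidecidable k (\<lambda>xs. P xs \<or> Q xs)"
proof -
  obtain f g where "recursive_fn (Suc k) f" "recursive_fn (Suc k) g"
    "\<And>xs. length xs = k \<Longrightarrow> P xs \<longleftrightarrow> (\<exists>y. f (y # xs) = 0)"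
    "\<And>xs. length xs = k \<Longrightarrow> Q xs \<longleftrightarrow> (\<exists>y. g (y # xs) = 0)"
    using assms unfolding semidecidable_def by blast
  then show ?thesis unfolding semidecidable_def
    by (intro exI[of _ "\<lambda>xs. f xs * g xs"]) (auto intro: recursive_fn_mult)
qed

text \<open>
  One bound \<open>y\<close> serves both for the quantified variable and for the witness of the matrix.
\<close>

lemma semidecidable_ex:
  assumes "semidecidable (Suc k) (\<lambda>xs. P (hd xs) (tl xs))"
  shows "semidecidable k (\<lambda>xs. \<exists>z. P z xs)"
proof -
  obtain f where f: "recursive_fn (Suc (Suc k)) (\<lambda>xs. f (hd xs) (tl xs))"
    "\<forall>xs. length xs = Suc k \<longrightarrow> (P (hd xs) (tl xs) \<longleftrightarrow> (\<exists>y. f y xs = 0))"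
    "\<forall>xs y z. f y xs = (0::nat) \<longrightarrow> y \<le> z \<longrightarrow> f z xs = 0"
    using semidecidable_mono_witness[OF assms] by (elim exE conjE)
  note f = f[rule_format]
  show ?thesis
  proof (rule semidecidableI[of k "\<lambda>y xs. \<Prod>z<y. f y (z # xs)"])
    have "recursive_map (Suc (Suc k)) (Suc (Suc k)) (\<lambda>xs. hd (tl xs) # hd xs # tl (tl xs))"
      by (intro recursive_map_Cons recursive_intros_base
        recursive_map_comp[OF recursive_map_tl recursive_map_tl])
    from recursive_fn_map[OF f(1) this]
    show "recursive_fn (Suc k) (\<lambda>xs. \<Prod>z<hd xs. f (hd xs) (z # tl xs))"
      by (intro recursive_fn_prod recursive_intros_base) simp
    fix xs :: "nat list" assume len: "length xs = k"
    have "\<exists>y. \<exists>z<y. f y (z # xs) = 0" if "f y (z # xs) = 0" for y z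
      using f(3)[OF that, of "max y (Suc z)"] by (intro exI[of _ "max y (Suc z)"] exI[of _ z]) auto
    then show "(\<exists>z. P z xs) \<longleftrightarrow> (\<exists>y. (\<Prod>z<y. f y (z # xs)) = 0)"
      using f(2)[of "_ # xs"] len by (auto simp: Bex_def)
  qed
qed

text \<open>
  Finitely many witnesses have a common upper bound (here their sum), so that the unbounded search
  moves outside the bounded quantifier.
\<close>

lemma semidecidable_all_less:
  assumes "recursive_fn k t" "semidecidable (Suc k) (\<lambda>xs. P (hd xs) (tl xs))"
  shows "semidecidable k (\<lambda>xs. \<forall>z<t xs. P z xs)"
proof -
  obtain f where f: "recursive_fn (Suc (Suc k)) (\<lambda>xs. f (hd xs) (tl xs))"
    "\<forall>xs. length xs = Suc k \<longrightarrow> (P (hd xs) (tl xs) \<longleftrightarrow> (\<exists>y. f y xs = 0))"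
    "\<forall>xs y z. f y xs = (0::nat) \<longrightarrow> y \<le> z \<longrightarrow> f z xs = 0"
    using semidecidable_mono_witness[OF assms(2)] by (elim exE conjE)
  note f = f[rule_format]
  show ?thesis
  proof (rule semidecidableI[of k "\<lambda>y xs. \<Sum>z<t xs. f y (z # xs)"])
    have "recursive_map (Suc (Suc k)) (Suc (Suc k)) (\<lambda>xs. hd (tl xs) # hd xs # tl (tl xs))"
      by (intro recursive_map_Cons recursive_intros_base
        recursive_map_comp[OF recursive_map_tl recursive_map_tl])
    from recursive_fn_map[OF f(1) this]
    show "recursive_fn (Suc k) (\<lambda>xs. \<Sum>z<t (tl xs). f (hd xs) (z # tl xs))"
      by (intro recursive_fn_sum recursive_intros_base assms(1)) simp
    fix xs :: "nat list" assume len: "length xs = k"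
    have "\<exists>y. \<forall>z<t xs. f y (z # xs) = 0"
      if ex: "\<forall>z<t xs. \<exists>y. f y (z # xs) = 0"
    proof -
      obtain Y where Y: "\<And>z. z < t xs \<Longrightarrow> f (Y z) (z # xs) = 0"
        using ex by metis
      have "f (\<Sum>z<t xs. Y z) (z # xs) = 0" if "z < t xs" for z
      proof (rule f(3)[OF Y[OF that]])
        show "Y z \<le> (\<Sum>z<t xs. Y z)" using that by (intro member_le_sum) auto
      qed
      then show ?thesis by blast
    qed
    moreover have "P z xs \<longleftrightarrow> (\<exists>y. f y (z # xs) = 0)" for z
      using f(2)[of "z # xs"] len by simp
    ultimately have "(\<forall>z<t xs. P z xs) \<longleftrightarrow> (\<exists>y. \<forall>z<t xs. f y (z # xs) = 0)" by blast
    then show "(\<forall>z<t xs. P z xs) \<longleftrightarrow> (\<exists>y. (\<Sum>z<t xs. f y (z # xs)) = 0)"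
      by (simp add: Ball_def)
  qed
qed

lemma semidecidable_const: "semidecidable k (\<lambda>xs. b)"
  using semidecidable_eq[OF recursive_fn_const recursive_fn_const, of k 0 "if b then 0 else 1"]
  by (cases b) auto

lemma semidecidable_less:
  assumes "recursive_fn k s" "recursive_fn k t"
  shows "semidecidable k (\<lambda>xs. s xs < t xs)"
proof -
  have "semidecidable k (\<lambda>xs. \<exists>d. s xs + Suc d = t xs)"
    by (intro semidecidable_ex semidecidable_eq recursive_fn_add recursive_intros_base assms)
  then show ?thesis by (simp add: less_iff_Suc_add eq_commute)
qed

lemma semidecidable_neq:
  assumes "recursive_fn k s" "recursive_fn k t"
  shows "semidecidable k (\<lambda>xs. s xs \<noteq> t xs)"
  unfolding nat_neq_iff by (intro semidecidable_disj semidecidable_less assms)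

lemma semidecidable_finite_ex:
  assumes "finite A" "\<And>a. a \<in> A \<Longrightarrow> semidecidable k (P a)"
  shows "semidecidable k (\<lambda>xs. \<exists>a\<in>A. P a xs)"
  using assms by (induction A) (auto intro: semidecidable_const semidecidable_disj)

lemma semidecidable_finite_all:
  assumes "finite A" "\<And>a. a \<in> A \<Longrightarrow> semidecidable k (P a)"
  shows "semidecidable k (\<lambda>xs. \<forall>a\<in>A. P a xs)"
  using assms by (induction A) (auto intro: semidecidable_const semidecidable_conj)

lemmas semidecidable_intros =
  semidecidable_eq semidecidable_neq semidecidable_less semidecidable_conj semidecidable_disj
  semidecidable_ex semidecidable_all_less semidecidable_finite_ex semidecidable_finite_all

lemmas recursive_intros =
  recursive_fn_const recursive_fn_hd recursive_fn_Suc recursive_fn_add recursive_fn_mult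
  recursive_fn_power recursive_fn_tl

lemma re_set_semidecidable:
  assumes "re_set M" "recursive_fn k t"
  shows "semidecidable k (\<lambda>xs. t xs \<in> M)"
proof (cases "M = {}")
  case False
  then obtain f where f: "computable f" and M: "M = range f"
    using assms(1) unfolding re_set_def by blast
  have "recursive_fn (Suc 0) (\<lambda>xs. f (hd xs))"
    using f unfolding computable_def One_nat_def
    by (rule extensional) (auto simp: hd_conv_nth length_Suc_conv)
  then have "recursive_fn m (\<lambda>xs. f (s xs))" if "recursive_fn m s" for m s
    using that by (rule recursive_fn_subst1)
  then have "semidecidable k (\<lambda>xs. \<exists>y. f y = t xs)"
    by (intro semidecidable_intros) (auto intro: recursive_intros assms)
  then show ?thesis by (auto simp: M image_iff eq_commute)
qed (simp add: semidecidable_const)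

text \<open>
  Post's theorem: search for a witness of membership and one of non-membership simultaneously; the
  first one found tells which of the two holds.
\<close>

lemma decidable_setI:
  assumes "semidecidable (Suc 0) (\<lambda>xs. hd xs \<in> M)" "semidecidable (Suc 0) (\<lambda>xs. hd xs \<notin> M)"
  shows "decidable_set M"
proof -
  obtain f where f: "recursive_fn (Suc (Suc 0)) f"
    and fM: "\<And>xs. length xs = Suc 0 \<Longrightarrow> hd xs \<in> M \<longleftrightarrow> (\<exists>y. f (y # xs) = 0)"
    using assms(1) unfolding semidecidable_def by blast
  obtain g where g: "recursive_fn (Suc (Suc 0)) g"
    and gM: "\<And>xs. length xs = Suc 0 \<Longrightarrow> hd xs \<notin> M \<longleftrightarrow> (\<exists>y. g (y # xs) = 0)"
    using assms(2) unfolding semidecidable_def by blast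
  define m where "m = (\<lambda>xs. LEAST y. f (y # xs) * g (y # xs) = 0)"
  have ex: "\<exists>y. f (y # xs) * g (y # xs) = 0" if "length xs = Suc 0" for xs
    using fM[OF that] gM[OF that] by auto
  have "recursive_fn (Suc 0) m"
    unfolding m_def using ex recursive_fn_mult[OF f g]
    by (intro minimisation[where f = "\<lambda>xs. f xs * g xs"]) auto
  then have "recursive_fn (Suc 0) (\<lambda>xs. Suc 0 - f (m xs # xs))"
    by (intro recursive_fn_diff recursive_fn_const recursive_fn_map[OF f]
      recursive_map_Cons recursive_map_id)
  moreover have char: "(if hd xs \<in> M then 1 else 0) = Suc 0 - f (m xs # xs)" if "length xs = Suc 0" for xs
  proof -
    have "f (m xs # xs) * g (m xs # xs) = 0" unfolding m_def using LeastI_ex[OF ex[OF that]] .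
    then consider "f (m xs # xs) = 0" | "f (m xs # xs) \<noteq> 0" "g (m xs # xs) = 0" by auto
    then show ?thesis
    proof cases
      case 1
      then show ?thesis using fM[OF that] by auto
    next
      case 2
      then show ?thesis using gM[OF that] by auto
    qed
  qed
  ultimately show ?thesis unfolding decidable_set_def computable_def One_nat_def
  proof (elim extensional, intro allI impI)
    fix xs :: "nat list" assume len: "length xs = Suc 0"
    then have "xs ! 0 = hd xs" by (cases xs) auto
    then show "(if xs ! 0 \<in> M then Suc 0 else 0) = Suc 0 - f (m xs # xs)"
      using char[OF len] by (simp only: One_nat_def)
  qed
qed

text \<open>
  The value at \<open>xs\<close> is found by searching for a number \<open>C\<close> that exceeds the value and at the same time
  bounds a witness for membership in the graph; the value is the only \<open>y < C\<close> with a witness. This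
  makes it enough to describe a function by its graph.
\<close>

lemma recursive_fn_of_graph:
  assumes "semidecidable (Suc k) (\<lambda>xs. F (tl xs) = hd xs)"
  shows "recursive_fn k F"
proof -
  obtain f where f: "recursive_fn (Suc (Suc k)) (\<lambda>xs. f (hd xs) (tl xs))"
    "\<forall>xs. length xs = Suc k \<longrightarrow> (F (tl xs) = hd xs \<longleftrightarrow> (\<exists>w. f w xs = 0))"
    "\<forall>xs y z. f y xs = (0::nat) \<longrightarrow> y \<le> z \<longrightarrow> f z xs = 0"
    using semidecidable_mono_witness[OF assms] by (elim exE conjE)
  define h where "h = (\<lambda>C xs. \<Prod>y<C. f C (y # xs))"
  define C where "C = (\<lambda>xs. LEAST C. h C xs = 0)"
  have swap: "recursive_map (Suc (Suc k)) (Suc (Suc k)) (\<lambda>xs. hd (tl xs) # hd xs # tl (tl xs))"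
    by (intro recursive_map_Cons recursive_intros
      recursive_map_comp[OF recursive_map_tl recursive_map_tl])
  have h: "recursive_fn (Suc k) (\<lambda>xs. h (hd xs) (tl xs))"
    unfolding h_def using recursive_fn_map[OF f(1) swap]
    by (intro recursive_fn_prod recursive_intros) simp
  have F: "F xs = y \<longleftrightarrow> (\<exists>w. f w (y # xs) = 0)" if "length xs = k" for xs y
    using f(2)[rule_format, of "y # xs"] that by simp
  have ex: "\<exists>C. h C xs = 0" if len: "length xs = k" for xs
  proof -
    obtain w where "f w (F xs # xs) = 0" using F[OF len] by blast
    then have "f (max w (Suc (F xs))) (F xs # xs) = 0"
      using f(3) max.cobounded1 by blast
    then have "h (max w (Suc (F xs))) xs = 0" unfolding h_def by (auto intro!: bexI[of _ "F xs"])
    then show ?thesis by blast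
  qed
  then have C: "recursive_fn k C"
    unfolding C_def using minimisation[OF h] by simp
  have "recursive_map (Suc k) (Suc (Suc k)) (\<lambda>xs. C (tl xs) # hd xs # tl xs)"
    by (intro recursive_map_Cons recursive_intros recursive_map_tl C)
  from recursive_fn_map[OF f(1) this]
  have "recursive_fn k (\<lambda>xs. \<Sum>y<C xs. y * (Suc 0 - f (C xs) (y # xs)))"
    by (intro recursive_fn_sum recursive_fn_mult recursive_fn_diff recursive_intros C) simp
  moreover have "F xs = (\<Sum>y<C xs. y * (Suc 0 - f (C xs) (y # xs)))" if len: "length xs = k" for xs
  proof -
    have "h (C xs) xs = 0" unfolding C_def using LeastI_ex[OF ex[OF len]] .
    then obtain y where y: "y < C xs" "f (C xs) (y # xs) = 0" by (auto simp: h_def)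
    then have Fy: "F xs = y" using F[OF len] by blast
    have "z * (Suc 0 - f (C xs) (z # xs)) = 0" if "z \<noteq> y" for z
    proof -
      have "f (C xs) (z # xs) \<noteq> 0" using F[OF len, of z] Fy that by auto
      then show ?thesis by simp
    qed
    then have "(\<Sum>z<C xs. z * (Suc 0 - f (C xs) (z # xs)))
        = (\<Sum>z<C xs. if z = y then y else 0)"
      using y by (intro sum.cong refl) auto
    then show ?thesis using y Fy by simp
  qed
  ultimately show ?thesis by (elim extensional) blast
qed

lemma recursive_fn_div:
  assumes "recursive_fn k s" "recursive_fn k t"
  shows "recursive_fn k (\<lambda>xs. s xs div t xs)"
proof (rule recursive_fn_of_graph)
  have "a div b = q \<longleftrightarrow> b = 0 \<and> q = 0 \<or> (\<exists>r. r < b \<and> a = q * b + r)" for a b q :: nat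
    by (cases "b = 0") (auto intro: exI[of _ "a mod b"])
  then show "semidecidable (Suc k) (\<lambda>xs. s (tl xs) div t (tl xs) = hd xs)"
    by (simp only:) (intro semidecidable_intros recursive_intros assms)
qed

section \<open>Coding of sequences and semidecidability of reachability\<close>

text \<open>
  Numbers in base \<open>\<beta> + 1\<close> code finite sequences with entries at most \<open>\<beta>\<close>. The shift by one keeps the base
  positive.
\<close>

definition digit :: "nat \<Rightarrow> nat \<Rightarrow> nat \<Rightarrow> nat" where
  "digit \<beta> c i = c div Suc \<beta> ^ i mod Suc \<beta>"

lemma digit_le: "digit \<beta> c i \<le> \<beta>"
  unfolding digit_def using mod_less_divisor[of "Suc \<beta>"] by (simp add: less_Suc_eq_le)

lemma recursive_fn_digit:
  assumes "recursive_fn k s" "recursive_fn k t" "recursive_fn k u"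
  shows "recursive_fn k (\<lambda>xs. digit (s xs) (t xs) (u xs))"
  unfolding digit_def modulo_nat_def
  by (intro recursive_fn_diff recursive_fn_div recursive_fn_mult recursive_fn_power
    recursive_fn_Suc assms)

lemma digits_exist:
  assumes "\<And>i. i < n \<Longrightarrow> y i \<le> \<beta>"
  shows "\<exists>c<Suc \<beta> ^ n. \<forall>i<n. digit \<beta> c i = y i"
  using assms
proof (induction n arbitrary: y)
  case (Suc n)
  from Suc.IH[of "\<lambda>i. y (Suc i)"] Suc.prems obtain c
    where c: "c < Suc \<beta> ^ n" "\<forall>i<n. digit \<beta> c i = y (Suc i)" by auto
  have y0: "y 0 < Suc \<beta>" using Suc.prems[of 0] by simp
  let ?d = "y 0 + Suc \<beta> * c"
  have "digit \<beta> ?d 0 = y 0" using y0 by (simp add: digit_def del: mult_Suc)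
  moreover have "digit \<beta> ?d (Suc i) = digit \<beta> c i" for i
    using y0 unfolding digit_def power_Suc div_mult2_eq by (simp del: mult_Suc)
  ultimately have "\<forall>i<Suc n. digit \<beta> ?d i = y i"
    using c(2) by (auto simp: less_Suc_eq_0_disj)
  moreover have "?d < Suc \<beta> ^ Suc n"
  proof -
    have "?d < Suc \<beta> * Suc c" using y0 by simp
    also have "\<dots> \<le> Suc \<beta> * Suc \<beta> ^ n" using c(1) by (intro mult_le_mono2) simp
    finally show ?thesis by simp
  qed
  ultimately show ?case by blast
qed simp

text \<open>
  A path of a relation is a finite sequence of numbers, which is coded by the digits of a single
  number in a large enough base.
\<close>

lemma semidecidable_rtranclp:
  assumes R: "\<And>k s t. recursive_fn k s \<Longrightarrow> recursive_fn k t \<Longrightarrow>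
      semidecidable k (\<lambda>xs. R (s xs) (t xs))"
    and st: "recursive_fn k s" "recursive_fn k t"
  shows "semidecidable k (\<lambda>xs. R\<^sup>*\<^sup>* (s xs) (t xs))"
proof -
  have *: "R\<^sup>*\<^sup>* a b \<longleftrightarrow> (\<exists>n \<beta> c. digit \<beta> c 0 = a \<and> digit \<beta> c n = b \<and>
      (\<forall>i<n. R (digit \<beta> c i) (digit \<beta> c (Suc i))))" (is "_ \<longleftrightarrow> ?E") for a b
  proof
    assume "R\<^sup>*\<^sup>* a b"
    then obtain n f where f: "f 0 = a" "f n = b" "\<forall>i<n. R (f i) (f (Suc i))"
      unfolding rtranclp_power relpowp_fun_conv by blast
    have "f i \<le> (\<Sum>i\<le>n. f i)" if "i < Suc n" for i
      using that by (intro member_le_sum) auto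
    from digits_exist[of "Suc n" f, OF this]
    obtain c where "\<forall>i<Suc n. digit (\<Sum>i\<le>n. f i) c i = f i" by blast
    then show ?E using f by (intro exI[of _ n] exI[of _ "\<Sum>i\<le>n. f i"] exI[of _ c]) simp
  next
    assume ?E
    then show "R\<^sup>*\<^sup>* a b"
      unfolding rtranclp_power relpowp_fun_conv by metis
  qed
  show ?thesis unfolding *
    by (intro semidecidable_intros R recursive_fn_digit recursive_intros st)
qed

lemma recursive_fn_prod_encode:
  assumes "recursive_fn k s" "recursive_fn k t"
  shows "recursive_fn k (\<lambda>xs. prod_encode (s xs, t xs))"
  unfolding prod_encode_def triangle_def split
  by (intro recursive_fn_div recursive_intros assms)

section \<open>Operations on coded words\<close>

definition code_Cons :: "nat \<Rightarrow> nat \<Rightarrow> nat" where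
  "code_Cons x l = Suc (prod_encode (x, l))"

lemma list_encode_Cons: "list_encode (x # w) = code_Cons x (list_encode w)"
  by (simp add: code_Cons_def)

lemma list_decode_code_Cons: "list_decode (code_Cons x l) = x # list_decode l"
  by (simp add: code_Cons_def)

lemma recursive_fn_code_Cons:
  assumes "recursive_fn k s" "recursive_fn k t"
  shows "recursive_fn k (\<lambda>xs. code_Cons (s xs) (t xs))"
  unfolding code_Cons_def by (intro recursive_fn_Suc recursive_fn_prod_encode assms)

definition code_revapp :: "nat \<Rightarrow> nat \<Rightarrow> nat" where
  "code_revapp m n = list_encode (rev (list_decode m) @ list_decode n)"

text \<open>
  Concatenation of words is computed by a machine with two stacks, whose step moves the top letter of
  the first stack to the second one. Started on \<open>u\<close> and \<open>v\<close>, it halts with \<open>rev u @ v\<close> on the second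
  stack, and reachability of this final state is semidecidable.
\<close>

definition revapp_step :: "nat \<Rightarrow> nat \<Rightarrow> bool" where
  "revapp_step s t \<longleftrightarrow> (\<exists>x a b. s = prod_encode (code_Cons x a, b) \<and>
     t = prod_encode (a, code_Cons x b))"

lemma revapp_step_run:
  "revapp_step\<^sup>*\<^sup>* (prod_encode (list_encode u, list_encode v)) (prod_encode (0, list_encode (rev u @ v)))"
proof (induction u arbitrary: v)
  case (Cons x u)
  have "revapp_step (prod_encode (list_encode (x # u), list_encode v))
      (prod_encode (list_encode u, list_encode (x # v)))"
    unfolding revapp_step_def list_encode_Cons by blast
  then show ?case using Cons[of "x # v"] by (simp add: converse_rtranclp_into_rtranclp)
qed simp

lemma revapp_step_invariant:
  assumes "revapp_step\<^sup>*\<^sup>* (prod_encode (m, n)) s"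
  shows "\<exists>a b. s = prod_encode (a, b) \<and> code_revapp a b = code_revapp m n"
  using assms
proof (induction)
  case (step s t)
  then show ?case
    by (auto simp: revapp_step_def code_revapp_def list_decode_code_Cons)
qed blast

lemma recursive_fn_code_revapp:
  assumes "recursive_fn k s" "recursive_fn k t"
  shows "recursive_fn k (\<lambda>xs. code_revapp (s xs) (t xs))"
proof (rule recursive_fn_of_graph)
  have *: "code_revapp m n = l \<longleftrightarrow> revapp_step\<^sup>*\<^sup>* (prod_encode (m, n)) (prod_encode (0, l))" for m n l
  proof
    assume "code_revapp m n = l"
    then show "revapp_step\<^sup>*\<^sup>* (prod_encode (m, n)) (prod_encode (0, l))"
      using revapp_step_run[of "list_decode m" "list_decode n"] by (simp add: code_revapp_def)
  next
    assume "revapp_step\<^sup>*\<^sup>* (prod_encode (m, n)) (prod_encode (0, l))"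
    from revapp_step_invariant[OF this] show "code_revapp m n = l"
      by (auto simp: code_revapp_def)
  qed
  have step: "semidecidable k (\<lambda>xs. revapp_step (s xs) (t xs))"
    if "recursive_fn k s" "recursive_fn k t" for k s t
    unfolding revapp_step_def
    by (intro semidecidable_intros recursive_fn_prod_encode recursive_fn_code_Cons recursive_intros that)
  then show "semidecidable (Suc k) (\<lambda>xs. code_revapp (s (tl xs)) (t (tl xs)) = hd xs)"
    unfolding * by (intro semidecidable_rtranclp step recursive_fn_prod_encode recursive_intros assms)
qed

definition code_append :: "nat \<Rightarrow> nat \<Rightarrow> nat" where
  "code_append m n = list_encode (list_decode m @ list_decode n)"

lemma recursive_fn_code_append:
  assumes "recursive_fn k s" "recursive_fn k t"
  shows "recursive_fn k (\<lambda>xs. code_append (s xs) (t xs))"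
proof -
  have *: "code_append m n = code_revapp (code_revapp m 0) n" for m n
    by (simp add: code_append_def code_revapp_def)
  show ?thesis unfolding *
    by (intro recursive_fn_code_revapp recursive_intros assms)
qed

lemma semidecidable_finite_mem:
  assumes "finite K" "recursive_fn k t"
  shows "semidecidable k (\<lambda>xs. t xs \<in> K)" "semidecidable k (\<lambda>xs. t xs \<notin> K)"
proof -
  have "semidecidable k (\<lambda>xs. \<exists>a\<in>K. t xs = a)" "semidecidable k (\<lambda>xs. \<forall>a\<in>K. t xs \<noteq> a)"
    by (intro semidecidable_intros recursive_intros assms)+
  moreover have "(\<exists>a\<in>K. y = a) \<longleftrightarrow> y \<in> K" "(\<forall>a\<in>K. y \<noteq> a) \<longleftrightarrow> y \<notin> K" for y
    by blast+
  ultimately show "semidecidable k (\<lambda>xs. t xs \<in> K)" "semidecidable k (\<lambda>xs. t xs \<notin> K)"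
    by (simp_all only:)
qed

text \<open>
  A word is over the finite alphabet \<open>K\<close> iff it can be emptied by removing initial letters from \<open>K\<close>.
\<close>

lemma semidecidable_in_lists:
  assumes "finite K" "recursive_fn k t"
  shows "semidecidable k (\<lambda>xs. list_decode (t xs) \<in> lists K)"
proof -
  define pop where "pop = (\<lambda>m n. \<exists>x. x \<in> K \<and> m = code_Cons x n)"
  have "pop\<^sup>*\<^sup>* (list_encode w) 0" if "w \<in> lists K" for w
    using that
  proof (induction w)
    case (Cons x w)
    then have "pop (list_encode (x # w)) (list_encode w)"
      unfolding pop_def list_encode_Cons by blast
    then show ?case using Cons by (simp add: converse_rtranclp_into_rtranclp)
  qed simp
  moreover have "list_decode m \<in> lists K" if "pop\<^sup>*\<^sup>* m 0" for m
    using that by (induction rule: converse_rtranclp_induct)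
      (auto simp: pop_def list_decode_code_Cons)
  ultimately have *: "list_decode m \<in> lists K \<longleftrightarrow> pop\<^sup>*\<^sup>* m 0" for m
    by (metis list_decode_inverse)
  show ?thesis unfolding *
  proof (rule semidecidable_rtranclp)
    show "semidecidable k (\<lambda>xs. pop (s xs) (t xs))"
      if "recursive_fn k s" "recursive_fn k t" for k s t
      unfolding pop_def by (intro semidecidable_ex semidecidable_conj semidecidable_eq
        semidecidable_finite_mem recursive_fn_code_Cons recursive_intros that assms)
  qed (intro assms recursive_intros)+
qed

lemma semidecidable_not_in_lists:
  assumes "finite K" "recursive_fn k t"
  shows "semidecidable k (\<lambda>xs. list_decode (t xs) \<notin> lists K)"
proof -
  have "list_decode m \<notin> lists K \<longleftrightarrow> (\<exists>p x q. m = code_append p (code_Cons x q) \<and> x \<notin> K)" for m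
  proof
    assume "list_decode m \<notin> lists K"
    then obtain x where "x \<in> set (list_decode m)" "x \<notin> K" by auto
    moreover from this obtain p q where "list_decode m = p @ x # q" by (auto dest: split_list)
    then have "m = code_append (list_encode p) (code_Cons x (list_encode q))"
      unfolding code_append_def list_decode_code_Cons list_encode_inverse
      by (metis list_decode_inverse)
    ultimately show "\<exists>p x q. m = code_append p (code_Cons x q) \<and> x \<notin> K" by blast
  qed (auto simp: code_append_def list_decode_code_Cons)
  then show ?thesis
    by (simp only:) (intro semidecidable_ex semidecidable_conj semidecidable_eq
        semidecidable_finite_mem recursive_fn_code_Cons recursive_fn_code_append recursive_intros assms)
qed

section \<open>Thue congruences\<close>

definition rewrite_step :: "('c list \<Rightarrow> 'c list \<Rightarrow> bool) \<Rightarrow> 'c list \<Rightarrow> 'c list \<Rightarrow> bool" where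
  "rewrite_step E u v \<longleftrightarrow> (\<exists>p q l r. (E l r \<or> E r l) \<and> u = p @ l @ q \<and> v = p @ r @ q)"

abbreviation thue :: "('c list \<Rightarrow> 'c list \<Rightarrow> bool) \<Rightarrow> 'c list \<Rightarrow> 'c list \<Rightarrow> bool" where
  "thue E \<equiv> (rewrite_step E)\<^sup>*\<^sup>*"

text \<open>
  Congruence is reachability for single rewriting steps, and such a step is an existential statement
  about concatenations.
\<close>

lemma semidecidable_thue:
  assumes E: "\<And>k s t. recursive_fn k s \<Longrightarrow> recursive_fn k t \<Longrightarrow>
      semidecidable k (\<lambda>xs. E (list_decode (s xs)) (list_decode (t xs)))"
    and st: "recursive_fn k s" "recursive_fn k t"
  shows "semidecidable k (\<lambda>xs. thue E (list_decode (s xs)) (list_decode (t xs)))"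
proof -
  define R where "R = (\<lambda>m n. rewrite_step E (list_decode m) (list_decode n))"
  have R: "R m n \<longleftrightarrow> (\<exists>p q l r. (E (list_decode l) (list_decode r) \<or> E (list_decode r) (list_decode l)) \<and>
      m = code_append p (code_append l q) \<and> n = code_append p (code_append r q))" for m n
  proof
    assume "R m n"
    then obtain p q l r where "E l r \<or> E r l"
      "list_decode m = p @ l @ q" "list_decode n = p @ r @ q"
      unfolding R_def rewrite_step_def by blast
    then have "E (list_decode (list_encode l)) (list_decode (list_encode r)) \<or>
        E (list_decode (list_encode r)) (list_decode (list_encode l))"
      "m = code_append (list_encode p) (code_append (list_encode l) (list_encode q))"
      "n = code_append (list_encode p) (code_append (list_encode r) (list_encode q))"
      unfolding code_append_def list_encode_inverse
      using list_decode_inverse[of m] list_decode_inverse[of n] by simp_all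
    then show "\<exists>p q l r. (E (list_decode l) (list_decode r) \<or> E (list_decode r) (list_decode l)) \<and>
      m = code_append p (code_append l q) \<and> n = code_append p (code_append r q)"
      by blast
  next
    assume "\<exists>p q l r. (E (list_decode l) (list_decode r) \<or> E (list_decode r) (list_decode l)) \<and>
      m = code_append p (code_append l q) \<and> n = code_append p (code_append r q)"
    then obtain p q l r where lr: "E (list_decode l) (list_decode r) \<or> E (list_decode r) (list_decode l)"
      and "m = code_append p (code_append l q)" "n = code_append p (code_append r q)" by blast
    then have "list_decode m = list_decode p @ list_decode l @ list_decode q"
      "list_decode n = list_decode p @ list_decode r @ list_decode q"
      by (simp_all add: code_append_def)
    then show "R m n" unfolding R_def rewrite_step_def using lr by blast
  qed
  have "thue E (list_decode m) (list_decode n)" if "R\<^sup>*\<^sup>* m n" for m n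
    using that by (induction) (auto simp: R_def intro: rtranclp.rtrancl_into_rtrancl)
  moreover have "R\<^sup>*\<^sup>* (list_encode u) (list_encode v)" if "thue E u v" for u v
    using that by (induction) (auto simp: R_def intro: rtranclp.rtrancl_into_rtrancl)
  ultimately have *: "thue E (list_decode m) (list_decode n) \<longleftrightarrow> R\<^sup>*\<^sup>* m n" for m n
    by (metis list_decode_inverse)
  have step: "semidecidable k (\<lambda>xs. R (s xs) (t xs))"
    if "recursive_fn k s" "recursive_fn k t" for k s t
    unfolding R by (intro semidecidable_ex semidecidable_conj semidecidable_disj semidecidable_eq
        E recursive_fn_code_append recursive_intros that)
  show ?thesis unfolding * by (intro semidecidable_rtranclp step st)
qed

section \<open>Numbered words in a recursively presented group\<close>

definition word_val :: "('a, 'm) monoid_scheme \<Rightarrow> (nat \<Rightarrow> 'a) \<Rightarrow> nat list \<Rightarrow> 'a" where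
  "word_val G \<gamma> w = foldr (\<lambda>k g. \<gamma> k \<otimes>\<^bsub>G\<^esub> g) w \<one>\<^bsub>G\<^esub>"

context group
begin

lemma word_val_closed:
  assumes "\<And>k. \<gamma> k \<in> carrier G"
  shows "word_val G \<gamma> w \<in> carrier G"
  by (induction w) (auto simp: word_val_def assms)

lemma word_val_append:
  assumes "\<And>k. \<gamma> k \<in> carrier G"
  shows "word_val G \<gamma> (u @ v) = word_val G \<gamma> u \<otimes> word_val G \<gamma> v"
proof (induction u)
  case Nil
  then show ?case using word_val_closed[of \<gamma> v] by (simp add: word_val_def assms)
next
  case (Cons k u)
  then show ?case
    using word_val_closed[of \<gamma> v] word_val_closed[of \<gamma> u] assms
    by (simp add: word_val_def m_assoc)
qed

end

lemma thue_sym: "thue E u v \<Longrightarrow> thue E v u"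
proof (induction rule: rtranclp_induct)
  case (step v w)
  then have "rewrite_step E w v" unfolding rewrite_step_def by blast
  then show ?case using step by (meson converse_rtranclp_into_rtranclp)
qed simp

lemma thue_context: "thue E u v \<Longrightarrow> thue E (p @ u @ q) (p @ v @ q)"
proof (induction rule: rtranclp_induct)
  case (step v w)
  then obtain p' q' l r where "E l r \<or> E r l" "v = p' @ l @ q'" "w = p' @ r @ q'"
    unfolding rewrite_step_def by blast
  then have "rewrite_step E (p @ v @ q) (p @ w @ q)" unfolding rewrite_step_def
    by (intro exI[of _ "p @ p'"] exI[of _ "q' @ q"] exI[of _ l] exI[of _ r]) auto
  then show ?case using step by (meson rtranclp.rtrancl_into_rtrancl)
qed simp

lemma thue_rule:
  assumes "E l r"
  shows "thue E (p @ l @ q) (p @ r @ q)"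
  using assms by (intro r_into_rtranclp) (auto simp: rewrite_step_def)

text \<open>
  Every number codes a word, hence an element of the group; the letters that matter form the finite
  set \<open>K\<close>, and all other numbers stand for arbitrary elements. The relation \<open>eqv\<close> is a
  semidecidable approximation to equality in the group: it never identifies different elements, and it
  is exact for words over \<open>K\<close>.
\<close>

locale coded_group = group G for G :: "('a, 'm) monoid_scheme" (structure) +
  fixes \<gamma> :: "nat \<Rightarrow> 'a" and K :: "nat set" and eqv :: "nat \<Rightarrow> nat \<Rightarrow> bool"
  assumes finite_K: "finite K"
    and gamma_closed: "\<gamma> k \<in> carrier G"
    and words_onto: "g \<in> carrier G \<Longrightarrow> \<exists>u\<in>lists K. word_val G \<gamma> u = g"
    and eqv_sound: "eqv m n \<Longrightarrow> word_val G \<gamma> (list_decode m) = word_val G \<gamma> (list_decode n)"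
    and eqv_complete: "u \<in> lists K \<Longrightarrow> v \<in> lists K \<Longrightarrow> word_val G \<gamma> u = word_val G \<gamma> v \<Longrightarrow>
      eqv (list_encode u) (list_encode v)"
    and semidecidable_eqv: "recursive_fn k s \<Longrightarrow> recursive_fn k t \<Longrightarrow>
      semidecidable k (\<lambda>xs. eqv (s xs) (t xs))"

text \<open>
  The elements of \<open>S\<close> are adjoined to the given presentation as new generators, each with a rule that
  replaces it by a word in the old ones. The Thue system formed by the relators, the free
  cancellations and these rules is recursively enumerable, and its congruence is equality in \<open>G\<close>.
\<close>

lemma recursively_presented_coded_group:
  assumes G: "group G" and S: "finite S" "S \<subseteq> carrier G" and "recursively_presented G"
  shows "\<exists>\<gamma> K eqv e. coded_group G \<gamma> K eqv \<and> inj_on e S \<and> e ` S \<subseteq> K \<and> (\<forall>s\<in>S. \<gamma> (e s) = s)"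
proof -
  interpret G: group G by fact
  obtain A :: "nat set" and R where A: "finite A" and R: "R \<subseteq> lists (sletters A)"
    and re: "re_language (sletters A) R" and iso: "presented_group A R \<cong> G"
    using assms(4) unfolding recursively_presented_def by blast
  let ?P = "presented_group A R" and ?L = "sletters A"
  obtain d where d: "inj_on d ?L" and re: "re_set ((\<lambda>w. list_encode (map d w)) ` R)"
    using re unfolding re_language_def by blast
  obtain \<psi> where \<psi>: "\<psi> \<in> iso ?P G" using iso unfolding is_iso_def by blast
  have P: "group ?P" using R by (rule group_presented_group)
  have hom: "\<psi> \<in> hom ?P G" and bij: "bij_betw \<psi> (carrier ?P) (carrier G)"
    using \<psi> unfolding iso_def by auto
  have finL: "finite ?L" using A by simp
  obtain e0 :: "'a \<Rightarrow> nat" where e0: "inj_on e0 S"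
    using finite_imp_inj_to_nat_seg[OF S(1)] by blast
  \<comment> \<open>The letters coming from \<open>S\<close> are numbered above all letters of the presentation.\<close>
  define e where "e = (\<lambda>s. Suc (Max (insert 0 (d ` ?L))) + e0 s)"
  have e: "inj_on e S" using e0 unfolding e_def inj_on_def by simp
  have disj: "e s \<notin> d ` ?L" for s
  proof
    assume "e s \<in> d ` ?L"
    then have "e s \<le> Max (insert 0 (d ` ?L))" using finL by (intro Max_ge) auto
    then show False by (simp add: e_def)
  qed
  define cl where "cl = (\<lambda>w. \<psi> (pres_class A R w))"
  have cl_closed: "cl w \<in> carrier G" if "w \<in> lists ?L" for w
    using hom that unfolding cl_def hom_def by (auto simp: presented_group_def)
  have cl_append: "cl (u @ v) = cl u \<otimes>\<^bsub>G\<^esub> cl v" if "u \<in> lists ?L" "v \<in> lists ?L" for u v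
  proof -
    have "pres_class A R u \<in> carrier ?P" "pres_class A R v \<in> carrier ?P"
      using that by (auto simp: presented_group_def)
    then show ?thesis
      using hom_mult[OF hom] presented_group_mult[OF R that] unfolding cl_def by metis
  qed
  have cl_Nil: "cl [] = \<one>\<^bsub>G\<^esub>"
    using hom_one[OF hom P G] unfolding cl_def by (simp add: presented_group_def)
  have cl_eq: "cl u = cl v" if "pres_eq A R u v" for u v
    unfolding cl_def using pres_class_eq[OF that] by simp
  have cl_inj: "pres_eq A R u v" if uv: "u \<in> lists ?L" "v \<in> lists ?L" "cl u = cl v" for u v
  proof -
    have "pres_class A R u \<in> carrier ?P" "pres_class A R v \<in> carrier ?P"
      using uv by (auto simp: presented_group_def)
    then have "pres_class A R u = pres_class A R v"
      using bij uv(3) unfolding cl_def bij_betw_def inj_on_def by blast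
    moreover have "v \<in> pres_class A R v"
      using uv(2) by (simp add: pres_class_def pres_eq.pe_refl)
    ultimately show ?thesis by (auto simp: pres_class_def)
  qed
  have cl_onto: "\<exists>w\<in>lists ?L. cl w = g" if "g \<in> carrier G" for g
  proof -
    have "g \<in> \<psi> ` carrier ?P" using that bij unfolding bij_betw_def by simp
    then show ?thesis unfolding cl_def by (auto simp: presented_group_def)
  qed
  define t where "t = (\<lambda>s. SOME w. w \<in> lists ?L \<and> cl w = s)"
  have t: "t s \<in> lists ?L" "cl (t s) = s" if "s \<in> S" for s
  proof -
    have "\<exists>w. w \<in> lists ?L \<and> cl w = s" using cl_onto S(2) that by blast
    from someI_ex[OF this] show "t s \<in> lists ?L" "cl (t s) = s" unfolding t_def by blast+
  qed
  define \<gamma> where "\<gamma> = (\<lambda>k. if k \<in> d ` ?L then cl [inv_into ?L d k]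
      else if k \<in> e ` S then inv_into S e k else \<one>\<^bsub>G\<^esub>)"
  have \<gamma>_d: "\<gamma> (d l) = cl [l]" if "l \<in> ?L" for l
    using that d unfolding \<gamma>_def by (auto simp: inv_into_f_f)
  have \<gamma>_e: "\<gamma> (e s) = s" if "s \<in> S" for s
    using that e disj unfolding \<gamma>_def by auto
  have \<gamma>_closed: "\<gamma> k \<in> carrier G" for k
  proof (cases "k \<in> d ` ?L")
    case True
    then obtain l where "l \<in> ?L" "k = d l" by blast
    then show ?thesis using \<gamma>_d[of l] cl_closed[of "[l]"] by simp
  next
    case False
    show ?thesis
    proof (cases "k \<in> e ` S")
      case True
      then show ?thesis using \<gamma>_e S(2) by auto
    next
      case False
      then show ?thesis using \<open>k \<notin> d ` ?L\<close> by (auto simp: \<gamma>_def)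
    qed
  qed
  let ?val = "word_val G \<gamma>"
  note val_append = G.word_val_append[where \<gamma> = \<gamma>, OF \<gamma>_closed]
  have val_d: "?val (map d w) = cl w" if "w \<in> lists ?L" for w
    using that
  proof (induction w)
    case Nil
    then show ?case by (simp add: word_val_def cl_Nil)
  next
    case (Cons l w)
    then have "?val (map d (l # w)) = cl [l] \<otimes>\<^bsub>G\<^esub> cl w" by (simp add: word_val_def \<gamma>_d)
    also have "\<dots> = cl ([l] @ w)" using Cons by (intro cl_append[symmetric]) auto
    finally show ?case by simp
  qed
  \<comment> \<open>Relators, free cancellations, and the definitions of the adjoined generators.\<close>
  define E where "E = (\<lambda>l r. (l \<in> map d ` R \<and> r = []) \<or>
     (\<exists>x\<in>?L. l = [d x, d (\<not> fst x, snd x)] \<and> r = []) \<or> (\<exists>s\<in>S. l = [e s] \<and> r = map d (t s)))"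
  have E_val: "?val l = ?val r" if "E l r" for l r
    using that unfolding E_def
  proof (elim disjE)
    assume "l \<in> map d ` R \<and> r = []"
    then obtain w where w: "w \<in> R" "l = map d w" "r = []" by blast
    then have "pres_eq A R w []" using pres_eq.relator[of "[]" A "[]" w R] by simp
    then show ?thesis using cl_eq w R val_d[of w] cl_Nil by (auto simp: word_val_def)
  next
    assume "\<exists>x\<in>?L. l = [d x, d (\<not> fst x, snd x)] \<and> r = []"
    then obtain b a where ba: "a \<in> A" "l = map d [(b, a), (\<not> b, a)]" "r = []" by auto
    then have "pres_eq A R [(b, a), (\<not> b, a)] []" using pres_eq.cancel[of "[]" A "[]" a R b] by simp
    then show ?thesis using ba cl_eq val_d[of "[(b, a), (\<not> b, a)]"] cl_Nil
      by (simp add: word_val_def)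
  next
    assume "\<exists>s\<in>S. l = [e s] \<and> r = map d (t s)"
    then obtain s where s: "s \<in> S" "l = [e s]" "r = map d (t s)" by blast
    then show ?thesis using \<gamma>_e[of s] val_d[OF t(1)] t(2) S(2) by (auto simp: word_val_def)
  qed
  have sound: "?val u = ?val v" if "thue E u v" for u v
    using that
  proof (induction)
    case (step v w)
    then obtain p q l r where "E l r \<or> E r l" "v = p @ l @ q" "w = p @ r @ q"
      unfolding rewrite_step_def by blast
    moreover from this have "?val l = ?val r" using E_val by metis
    ultimately have "?val v = ?val w" by (simp add: val_append)
    then show ?case using step by simp
  qed simp
  have thue_pres: "thue E (map d u) (map d v)" if "pres_eq A R u v" for u v
    using that
  proof (induction)
    case (cancel u v a b)
    have "E [d (b, a), d (\<not> b, a)] []"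
      unfolding E_def using cancel by (auto intro!: bexI[of _ "(b, a)"])
    from thue_rule[of E, OF this, of "map d u" "map d v"] show ?case by simp
  next
    case (relator u v r)
    then have "E (map d r) []" unfolding E_def by blast
    from thue_rule[of E, OF this, of "map d u" "map d v"] show ?case by simp
  qed (auto intro: thue_sym rtranclp_trans)
  define K where "K = d ` ?L \<union> e ` S"
  have to_d: "\<exists>w\<in>lists ?L. thue E u (map d w)" if "u \<in> lists K" for u
    using that
  proof (induction u)
    case (Cons k u)
    then obtain w where w: "w \<in> lists ?L" "thue E u (map d w)" by auto
    then have 1: "thue E (k # u) (k # map d w)" using thue_context[of E u "map d w" "[k]" "[]"] by simp
    from Cons consider l where "l \<in> ?L" "k = d l" | s where "s \<in> S" "k = e s"
      unfolding K_def by auto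
    then show ?case
    proof cases
      case 1
      then show ?thesis using \<open>thue E (k # u) (k # map d w)\<close> w by (intro bexI[of _ "l # w"]) auto
    next
      case 2
      have "E [k] (map d (t s))" using 2 unfolding E_def by blast
      from thue_rule[of E, OF this, of "[]" "map d w"]
      have "thue E (k # map d w) (map d (t s @ w))" by simp
      then show ?thesis using 1 w t(1)[OF 2(1)]
        by (intro bexI[of _ "t s @ w"]) (auto intro: rtranclp_trans)
    qed
  qed (auto intro: bexI[of _ "[]"])
  have complete: "thue E u v" if uv: "u \<in> lists K" "v \<in> lists K" "?val u = ?val v" for u v
  proof -
    obtain u' where u': "u' \<in> lists ?L" "thue E u (map d u')" using to_d uv(1) by blast
    obtain v' where v': "v' \<in> lists ?L" "thue E v (map d v')" using to_d uv(2) by blast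
    have "cl u' = cl v'" using sound[OF u'(2)] sound[OF v'(2)] uv(3) val_d u'(1) v'(1) by simp
    then have "thue E (map d u') (map d v')" using cl_inj thue_pres u'(1) v'(1) by blast
    then show ?thesis using u'(2) thue_sym[OF v'(2)] by (meson rtranclp_trans)
  qed
  have semi_E: "semidecidable k (\<lambda>xs. E (list_decode (s xs)) (list_decode (t' xs)))"
    if st: "recursive_fn k s" "recursive_fn k t'" for k s t'
  proof -
    have dec: "list_decode m = w \<longleftrightarrow> m = list_encode w" for m w by auto
    have "list_decode m \<in> map d ` R \<longleftrightarrow> m \<in> (\<lambda>w. list_encode (map d w)) ` R" for m
      by (auto simp: dec image_iff)
    then have *: "E (list_decode m) (list_decode n) \<longleftrightarrow>
       (m \<in> (\<lambda>w. list_encode (map d w)) ` R \<and> n = 0) \<or>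
       (\<exists>x\<in>?L. m = list_encode [d x, d (\<not> fst x, snd x)] \<and> n = 0) \<or>
       (\<exists>s\<in>S. m = list_encode [e s] \<and> n = list_encode (map d (t s)))" for m n
      unfolding E_def dec by simp
    show ?thesis unfolding *
      by (intro semidecidable_disj semidecidable_conj semidecidable_finite_ex finL S(1)
        semidecidable_eq re_set_semidecidable re recursive_fn_const st)
  qed
  have "coded_group G \<gamma> K (\<lambda>m n. thue E (list_decode m) (list_decode n))"
  proof
    show "finite K" unfolding K_def using finL S(1) by blast
    show "\<exists>u\<in>lists K. ?val u = g" if g: "g \<in> carrier G" for g
    proof -
      obtain w where w: "w \<in> lists ?L" "cl w = g" using cl_onto[OF g] by blast
      have "map d w \<in> lists (d ` ?L)" using w(1) unfolding lists_image by (rule imageI)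
      then have "map d w \<in> lists K" unfolding K_def using lists_mono[of "d ` ?L"] by blast
      then show ?thesis using val_d[OF w(1)] w(2) by (intro bexI[of _ "map d w"]) simp_all
    qed
    show "semidecidable k (\<lambda>xs. thue E (list_decode (s xs)) (list_decode (t xs)))"
      if "recursive_fn k s" "recursive_fn k t" for k s t
      using semi_E that by (rule semidecidable_thue)
    show "\<gamma> k \<in> carrier G" for k by (rule \<gamma>_closed)
    show "?val (list_decode m) = ?val (list_decode n)"
      if "thue E (list_decode m) (list_decode n)" for m n
      using that by (rule sound)
    show "thue E (list_decode (list_encode u)) (list_decode (list_encode v))"
      if "u \<in> lists K" "v \<in> lists K" "?val u = ?val v" for u v
      using complete[OF that] by simp
  qed
  moreover have "e ` S \<subseteq> K" by (simp add: K_def)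
  ultimately show ?thesis using e \<gamma>_e by blast
qed

section \<open>Compactness\<close>

text \<open>
  Koenig's lemma for sequences with entries at most \<open>\<beta>\<close>: here \<open>C N x\<close> says that the first \<open>N\<close> entries of
  \<open>x\<close> contain a conflict. A prefix that extends to conflict-free sequences of every length keeps
  this property under at least one of the \<open>\<beta> + 1\<close> possible next entries, since otherwise the sum of
  the lengths at which these entries fail would be a length at which the prefix itself fails.
\<close>

lemma bounded_koenig:
  fixes C :: "nat \<Rightarrow> (nat \<Rightarrow> nat) \<Rightarrow> bool"
  assumes mono: "\<And>N M x. C N x \<Longrightarrow> N \<le> M \<Longrightarrow> C M x"
    and locality: "\<And>N x y. (\<And>i. i < N \<Longrightarrow> x i = y i) \<Longrightarrow> C N x \<Longrightarrow> C N y"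
    and avoid: "\<And>N. \<exists>x. (\<forall>i. x i \<le> \<beta>) \<and> \<not> C N x"
  shows "\<exists>x. \<forall>N. \<not> C N x"
proof -
  \<comment> \<open>Prefixes of length \<open>n\<close> with conflict-free extensions for every bound \<open>N\<close>.\<close>
  define ok where "ok = (\<lambda>n f. \<forall>N. \<exists>x. (\<forall>i. x i \<le> \<beta>) \<and> (\<forall>i<n. x i = f i) \<and> \<not> C N x)"
  have ok0: "ok 0 (\<lambda>_. 0)" using avoid by (auto simp: ok_def)
  have okS: "\<exists>g. ok (Suc n) g \<and> (\<forall>i<n. g i = f i)" if ok: "ok n f" for n f
  proof (rule ccontr)
    assume no: "\<not> ?thesis"
    have "\<not> ok (Suc n) (f(n := b))" for b
    proof
      assume "ok (Suc n) (f(n := b))"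
      then have "ok (Suc n) (f(n := b)) \<and> (\<forall>i<n. (f(n := b)) i = f i)" by simp
      with no show False by blast
    qed
    then have "\<exists>N. \<forall>x. (\<forall>i. x i \<le> \<beta>) \<longrightarrow> (\<forall>i<Suc n. x i = (f(n := b)) i) \<longrightarrow> C N x" for b
      unfolding ok_def by blast
    then obtain T where T: "\<And>b x. \<forall>i. x i \<le> \<beta> \<Longrightarrow> \<forall>i<Suc n. x i = (f(n := b)) i \<Longrightarrow> C (T b) x"
      by metis
    obtain x where x: "\<forall>i. x i \<le> \<beta>" "\<forall>i<n. x i = f i" "\<not> C (\<Sum>b\<le>\<beta>. T b) x"
      using ok unfolding ok_def by blast
    have "\<forall>i<Suc n. x i = (f(n := x n)) i" using x(2) by (simp add: less_Suc_eq)
    then have "C (T (x n)) x" by (rule T[OF x(1)])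
    moreover have "T (x n) \<le> (\<Sum>b\<le>\<beta>. T b)" using x(1) by (intro member_le_sum) auto
    ultimately show False using mono x(3) by blast
  qed
  have "\<exists>f. \<forall>n. ok n (f n) \<and> (\<forall>i<n. f (Suc n) i = f n i)"
    by (rule dependent_nat_choice) (use ok0 okS in blast)+
  then obtain f where f: "\<And>n. ok n (f n)" "\<And>n i. i < n \<Longrightarrow> f (Suc n) i = f n i" by blast
  \<comment> \<open>The prefixes stabilise, and their limit is the diagonal sequence.\<close>
  have stable: "f (n + j) i = f n i" if "i < n" for n i j
    by (induction j) (use that f(2) in auto)
  define x where "x = (\<lambda>i. f (Suc i) i)"
  have "\<not> C N x" for N
  proof
    assume C: "C N x"
    obtain y where y: "\<forall>i<N. y i = f N i" "\<not> C N y" using f(1)[of N] unfolding ok_def by blast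
    have "x i = y i" if "i < N" for i
      using y(1) that stable[of i "Suc i" "N - Suc i"] by (simp add: x_def)
    then show False using locality[OF _ C] y(2) by blast
  qed
  then show ?thesis by blast
qed

section \<open>Finite windows in sofic covers\<close>

context group
begin

lemma mem_SFT_iff:
  assumes P: "P \<subseteq> patterns G B"
    and Z: "Z = full_shift G B \<inter> (\<Inter>(F, p)\<in>P. \<Inter>g\<in>carrier G.
        full_shift G B - (\<Inter>h\<in>F. cylinder G B (g \<otimes> h) (p h)))"
  shows "z \<in> Z \<longleftrightarrow> z \<in> full_shift G B \<and>
    (\<forall>(F, p)\<in>P. \<forall>g\<in>carrier G. \<exists>h\<in>F. z (g \<otimes> h) \<noteq> p h)"
  unfolding Z cylinder_def by (auto split: prod.splits) blast+

lemma SFT_shift: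
  assumes Z: "SFT G B Z" and g: "g \<in> carrier G" and z: "z \<in> Z"
  shows "shift G g z \<in> Z"
proof -
  obtain P where P: "P \<subseteq> patterns G B"
    "Z = full_shift G B \<inter> (\<Inter>(F, p)\<in>P. \<Inter>g\<in>carrier G.
        full_shift G B - (\<Inter>h\<in>F. cylinder G B (g \<otimes> h) (p h)))"
    using Z unfolding SFT_def by blast
  note Z_iff = mem_SFT_iff[OF P]
  have "\<exists>h\<in>F. shift G g z (k \<otimes> h) \<noteq> p h" if "(F, p) \<in> P" and k: "k \<in> carrier G" for F p k
  proof -
    have "\<exists>h\<in>F. z (inv g \<otimes> k \<otimes> h) \<noteq> p h" using z that g unfolding Z_iff by blast
    moreover have "F \<subseteq> carrier G" using P(1) that by (auto simp: patterns_def)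
    ultimately show ?thesis using g k by (auto simp: shift_def m_assoc subset_iff)
  qed
  moreover have "shift G g z \<in> full_shift G B"
    using z g unfolding Z_iff by (auto simp: full_shift_def shift_def PiE_iff)
  ultimately show ?thesis unfolding Z_iff by blast
qed

text \<open>
  Let \<open>z\<close> be a preimage of the configuration whose only 1 is at the neutral element. By continuity the
  restriction \<open>q\<close> of \<open>z\<close> to a finite window \<open>W\<close> forces a 1 at the neutral element in the image, and by
  equivariance the translate of \<open>q\<close> by \<open>g\<close> forces a 1 at \<open>g\<close>. An element of the SFT that shows \<open>q\<close> at two
  places would therefore map to a configuration with two ones.
\<close>

lemma sofic_X_le1_marker:
  assumes "sofic G {0, 1} (X_le1 G)"
  obtains B :: "nat set" and Z W q where "finite B" "SFT G B Z" "finite W" "W \<subseteq> carrier G"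
    "\<exists>z\<in>Z. \<forall>h\<in>W. z h = q h"
    "\<forall>z\<in>Z. \<forall>g\<in>carrier G. (\<forall>h\<in>W. z h = q h) \<longrightarrow> (\<forall>h\<in>W. z (g \<otimes> h) = q h) \<longrightarrow> g = \<one>"
proof -
  obtain B Z \<phi> where B: "finite (B :: nat set)" and Z: "SFT G B Z"
    and cont: "continuous_map (subtopology (shift_topology G B) Z)
      (subtopology (shift_topology G {0, 1}) (X_le1 G)) \<phi>"
    and equi: "\<forall>g\<in>carrier G. \<forall>z\<in>Z. \<phi> (shift G g z) = shift G g (\<phi> z)"
    and onto: "\<phi> ` Z = X_le1 G"
    using assms unfolding sofic_def by blast
  have Z_full: "Z \<subseteq> full_shift G B" using Z unfolding SFT_def by blast
  have top: "topspace (shift_topology G B) = full_shift G B"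
    by (simp add: shift_topology_def full_shift_def)
  define \<delta> where "\<delta> = (\<lambda>g\<in>carrier G. if g = \<one> then 1 else 0 :: nat)"
  have "\<delta> \<in> X_le1 G" by (auto simp: \<delta>_def X_le1_def full_shift_def split: if_splits)
  then obtain z0 where z0: "z0 \<in> Z" "\<phi> z0 = \<delta>" using onto by (metis imageE)
  have "continuous_map (shift_topology G {0, 1}) (discrete_topology {0, 1 :: nat}) (\<lambda>x. x \<one>)"
    unfolding shift_topology_def by (rule continuous_map_product_projection) simp
  then have "continuous_map (subtopology (shift_topology G B) Z) (discrete_topology {0, 1 :: nat})
      ((\<lambda>x. x \<one>) \<circ> \<phi>)"
    using cont by (intro continuous_map_compose[of _ "shift_topology G {0, 1}"])
      (auto simp: continuous_map_in_subtopology)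
  from openin_continuous_map_preimage[OF this, of "{1}"]
  have "openin (subtopology (shift_topology G B) Z)
      {z \<in> topspace (subtopology (shift_topology G B) Z). ((\<lambda>x. x \<one>) \<circ> \<phi>) z \<in> {1}}" by simp
  then obtain V where V: "openin (shift_topology G B) V"
    "{z \<in> topspace (subtopology (shift_topology G B) Z). ((\<lambda>x. x \<one>) \<circ> \<phi>) z \<in> {1}} = V \<inter> Z"
    unfolding openin_subtopology by metis
  have V_iff: "z \<in> V \<longleftrightarrow> \<phi> z \<one> = 1" if "z \<in> Z" for z
    using V(2) that Z_full top by (auto simp: set_eq_iff)
  have "z0 \<in> V" using V_iff[OF z0(1)] z0(2) by (simp add: \<delta>_def)
  then obtain U where U: "finite {i \<in> carrier G. U i \<noteq> B}" "z0 \<in> Pi\<^sub>E (carrier G) U"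
    "Pi\<^sub>E (carrier G) U \<subseteq> V"
    using V(1) unfolding shift_topology_def openin_product_topology_alt by auto
  define W where "W = {i \<in> carrier G. U i \<noteq> B}"
  have marker: "\<phi> z \<one> = 1" if z: "z \<in> Z" and "\<forall>h\<in>W. z h = z0 h" for z
  proof -
    have "z i \<in> U i" if "i \<in> carrier G" for i
    proof (cases "i \<in> W")
      case True
      then show ?thesis using \<open>\<forall>h\<in>W. z h = z0 h\<close> U(2) that by (auto simp: PiE_iff)
    next
      case False
      then show ?thesis using z Z_full that by (auto simp: W_def full_shift_def PiE_iff)
    qed
    then have "z \<in> Pi\<^sub>E (carrier G) U" using z Z_full by (auto simp: full_shift_def PiE_iff)
    then show ?thesis using U(3) V_iff[OF z] by blast
  qed
  show thesis
  proof (rule that[of B Z W z0])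
    have "g = \<one>" if z: "z \<in> Z" and g: "g \<in> carrier G" and
      1: "\<forall>h\<in>W. z h = z0 h" and 2: "\<forall>h\<in>W. z (g \<otimes> h) = z0 h" for z g
    proof -
      have "shift G (inv g) z h = z (g \<otimes> h)" if "h \<in> carrier G" for h
        using g that by (simp add: shift_def)
      then have "\<forall>h\<in>W. shift G (inv g) z h = z0 h" using 2 by (auto simp: W_def)
      then have "\<phi> (shift G (inv g) z) \<one> = 1" using SFT_shift[OF Z _ z] g by (intro marker) auto
      moreover have "\<phi> (shift G (inv g) z) = shift G (inv g) (\<phi> z)" using equi z g by simp
      moreover have "shift G (inv g) (\<phi> z) \<one> = \<phi> z g" using g by (simp add: shift_def)
      ultimately have "\<phi> z g = 1" by simp
      moreover have "\<phi> z \<in> X_le1 G" using onto z by blast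
      ultimately show "g = \<one>" using marker[OF z 1] g by (auto simp: X_le1_def)
    qed
    then show "\<forall>z\<in>Z. \<forall>g\<in>carrier G. (\<forall>h\<in>W. z h = z0 h) \<longrightarrow> (\<forall>h\<in>W. z (g \<otimes> h) = z0 h) \<longrightarrow> g = \<one>" by blast
  qed (use B Z U(1) z0 in \<open>auto simp: W_def\<close>)
qed

end

section \<open>Refutation of nontrivial words\<close>

context coded_group
begin

abbreviation val :: "nat \<Rightarrow> 'a" where
  "val n \<equiv> word_val G \<gamma> (list_decode n)"

definition code :: "'a \<Rightarrow> nat" where
  "code g = list_encode (SOME u. u \<in> lists K \<and> word_val G \<gamma> u = g)"

lemma code:
  assumes "g \<in> carrier G"
  shows "list_decode (code g) \<in> lists K" "val (code g) = g"
proof -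
  have "\<exists>u. u \<in> lists K \<and> word_val G \<gamma> u = g" using words_onto[OF assms] by blast
  from someI_ex[OF this] show "list_decode (code g) \<in> lists K" "val (code g) = g"
    by (simp_all add: code_def)
qed

lemma val_closed: "val n \<in> carrier G"
  by (intro word_val_closed gamma_closed)

lemma val_append: "val (code_append m n) = val m \<otimes> val n"
  unfolding code_append_def by (simp add: word_val_append gamma_closed)

lemma list_decode_append: "list_decode (code_append m n) = list_decode m @ list_decode n"
  by (simp add: code_append_def)

lemma eqv_codes:
  assumes "list_decode m \<in> lists K" "list_decode n \<in> lists K" "val m = val n"
  shows "eqv m n"
  using eqv_complete[OF assms] by simp

text \<open>
  Here \<open>x\<close> colours the words, of which only those with code below \<open>N\<close> are inspected. A conflict is a
  visible reason why \<open>x\<close> does not come from an element of the SFT showing \<open>q\<close> both at the neutral element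
  and at the element represented by \<open>n\<close>. In turn: a colour outside the alphabet, different colours
  for words known to be equal, a forbidden pattern (translated by \<open>m\<close>), and a deviation
  from \<open>q\<close> at either of the two places.
\<close>

definition conflict ::
  "nat set \<Rightarrow> ('a set \<times> ('a \<Rightarrow> nat)) set \<Rightarrow> 'a set \<Rightarrow> ('a \<Rightarrow> nat) \<Rightarrow> nat \<Rightarrow> nat \<Rightarrow> (nat \<Rightarrow> nat) \<Rightarrow> bool" where
  "conflict B P W q n N x \<longleftrightarrow>
     (\<exists>i. i < N \<and> x i \<notin> B) \<or>
     (\<exists>i j. i < N \<and> j < N \<and> eqv i j \<and> x i \<noteq> x j) \<or>
     (\<exists>D\<in>P. \<exists>m. \<forall>h\<in>fst D. code_append m (code h) < N \<and> x (code_append m (code h)) = snd D h) \<or>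
     (\<exists>h\<in>W. code h < N \<and> x (code h) \<noteq> q h) \<or>
     (\<exists>h\<in>W. code_append n (code h) < N \<and> x (code_append n (code h)) \<noteq> q h)"

text \<open>
  The colourings of the words below \<open>N\<close> are listed as the \<open>N\<close>-digit numbers in base \<open>Max B + 1\<close>, so that the
  search through all of them is a bounded quantifier.
\<close>

definition refuted ::
  "nat set \<Rightarrow> ('a set \<times> ('a \<Rightarrow> nat)) set \<Rightarrow> 'a set \<Rightarrow> ('a \<Rightarrow> nat) \<Rightarrow> nat \<Rightarrow> bool" where
  "refuted B P W q n \<longleftrightarrow>
    (\<exists>N. \<forall>\<alpha><Suc (Max B) ^ N. conflict B P W q n N (digit (Max B) \<alpha>))"

lemma semidecidable_refuted:
  assumes "finite B" "finite P" "P \<subseteq> patterns G B" "finite W" "recursive_fn k t"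
  shows "semidecidable k (\<lambda>xs. refuted B P W q (t xs))"
proof -
  have F: "finite (fst D)" if "D \<in> P" for D
    using assms(3) that by (auto simp: patterns_def)
  show ?thesis
    unfolding refuted_def conflict_def
    by (intro semidecidable_intros semidecidable_finite_mem recursive_fn_digit
      recursive_fn_code_append semidecidable_eqv recursive_intros assms F)
qed

lemma conflict_mono:
  assumes "conflict B P W q n N x" "N \<le> M"
  shows "conflict B P W q n M x"
  using assms(1) unfolding conflict_def
  by (elim disjE) (use order_less_le_trans[OF _ assms(2)] in blast)+

lemma conflict_local:
  assumes eq: "\<And>i. i < N \<Longrightarrow> x i = y i" and "conflict B P W q n N x"
  shows "conflict B P W q n N y"
  using assms(2) unfolding conflict_def
  by (elim disjE) (use eq in metis)+

text \<open>
  If \<open>n\<close> represents the neutral element, then the element of the SFT showing \<open>q\<close> colours all words without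
  any conflict. If no \<open>N\<close> refutes \<open>n\<close>, then compactness gives a colouring of all words that is free of
  conflicts; it is constant on words representing the same element, so it descends to an element of
  the SFT that shows \<open>q\<close> at the neutral element and at the one represented by \<open>n\<close>, and \<open>sep\<close> identifies these.
\<close>

lemma refuted_iff_nontrivial:
  assumes B: "finite B" and P: "finite P" "P \<subseteq> patterns G B"
    and Z: "Z = full_shift G B \<inter> (\<Inter>(F, p)\<in>P. \<Inter>g\<in>carrier G.
        full_shift G B - (\<Inter>h\<in>F. cylinder G B (g \<otimes> h) (p h)))"
    and W: "finite W" "W \<subseteq> carrier G"
    and z0: "\<exists>z\<in>Z. \<forall>h\<in>W. z h = q h"
    and sep: "\<forall>z\<in>Z. \<forall>g\<in>carrier G. (\<forall>h\<in>W. z h = q h) \<longrightarrow> (\<forall>h\<in>W. z (g \<otimes> h) = q h) \<longrightarrow> g = \<one>"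
    and n: "list_decode n \<in> lists K"
  shows "refuted B P W q n \<longleftrightarrow> val n \<noteq> \<one>"
proof
  note Z_iff = mem_SFT_iff[OF P(2) Z]
  have F: "F \<subseteq> carrier G" "finite F" if "(F, p) \<in> P" for F p
    using P(2) that by (auto simp: patterns_def)
  show "val n \<noteq> \<one>" if ref: "refuted B P W q n"
  proof
    assume triv: "val n = \<one>"
    obtain z where z: "z \<in> Z" "\<forall>h\<in>W. z h = q h" using z0 by blast
    obtain N where N: "\<forall>\<alpha><Suc (Max B) ^ N. conflict B P W q n N (digit (Max B) \<alpha>)"
      using ref unfolding refuted_def by blast
    have zB: "z (val i) \<in> B" for i
      using z(1) val_closed[of i] unfolding Z_iff by (auto simp: full_shift_def PiE_iff)
    obtain \<alpha> where \<alpha>: "\<alpha> < Suc (Max B) ^ N" "\<forall>i<N. digit (Max B) \<alpha> i = z (val i)"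
      using digits_exist[of N "\<lambda>i. z (val i)" "Max B", OF Max_ge[OF B zB]] by blast
    have "conflict B P W q n N (\<lambda>i. z (val i))"
      by (rule conflict_local[OF _ N[rule_format, OF \<alpha>(1)]]) (use \<alpha>(2) in blast)
    then show False unfolding conflict_def
    proof (elim disjE)
      assume "\<exists>D\<in>P. \<exists>m. \<forall>h\<in>fst D. code_append m (code h) < N \<and>
          z (val (code_append m (code h))) = snd D h"
      then obtain F' p m where D: "(F', p) \<in> P"
        "\<And>h. h \<in> F' \<Longrightarrow> z (val (code_append m (code h))) = p h" by fastforce
      have "z (val m \<otimes> h) = p h" if "h \<in> F'" for h
      proof -
        have "h \<in> carrier G" using F(1)[OF D(1)] that by blast
        then show ?thesis using D(2)[OF that] by (simp add: val_append code(2))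
      qed
      moreover have "\<exists>h\<in>F'. z (val m \<otimes> h) \<noteq> p h"
        using z(1) val_closed[of m] D(1) unfolding Z_iff by fast
      ultimately show False by blast
    next
      assume "\<exists>h\<in>W. code h < N \<and> z (val (code h)) \<noteq> q h"
      then obtain h where "h \<in> W" "z (val (code h)) \<noteq> q h" by blast
      then show False using z(2) W(2) code(2)[of h] by auto
    next
      assume "\<exists>h\<in>W. code_append n (code h) < N \<and> z (val (code_append n (code h))) \<noteq> q h"
      then obtain h where h: "h \<in> W" "z (val (code_append n (code h))) \<noteq> q h" by blast
      then have "h \<in> carrier G" using W(2) by blast
      then have "val (code_append n (code h)) = h" by (simp add: val_append triv code(2))
      then show False using z(2) h by simp
    next
      assume "\<exists>i j. i < N \<and> j < N \<and> eqv i j \<and> z (val i) \<noteq> z (val j)"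
      then obtain i j where "eqv i j" "z (val i) \<noteq> z (val j)" by blast
      then show False using eqv_sound[of i j] by simp
    next
      assume "\<exists>i. i < N \<and> z (val i) \<notin> B"
      then show False using zB by blast
    qed
  qed
  show "refuted B P W q n" if nontriv: "val n \<noteq> \<one>"
  proof (rule ccontr)
    assume "\<not> refuted B P W q n"
    then have avoid: "\<exists>x. (\<forall>i. x i \<le> Max B) \<and> \<not> conflict B P W q n N x" for N
      unfolding refuted_def using digit_le by blast
    have "\<exists>x. \<forall>N. \<not> conflict B P W q n N x"
    proof (rule bounded_koenig)
      show "conflict B P W q n M x" if "conflict B P W q n N x" "N \<le> M" for N M x
        using that by (rule conflict_mono)
      show "conflict B P W q n N y" if "\<And>i. i < N \<Longrightarrow> x i = y i" "conflict B P W q n N x" for N x y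
        using that by (rule conflict_local)
    qed (rule avoid)
    then obtain x where x: "\<And>N. \<not> conflict B P W q n N x" by blast
    have xB: "x i \<in> B" for i
      using x[of "Suc i"] unfolding conflict_def by blast
    have x_eqv: "x i = x j" if "eqv i j" for i j
    proof (rule ccontr)
      assume "x i \<noteq> x j"
      moreover have "i < Suc (max i j)" "j < Suc (max i j)" by auto
      ultimately show False using x[of "Suc (max i j)"] that unfolding conflict_def by blast
    qed
    define z where "z = (\<lambda>g\<in>carrier G. x (code g))"
    have z_mult: "z (val m \<otimes> h) = x (code_append m (code h))"
      if "list_decode m \<in> lists K" "h \<in> carrier G" for m h
    proof -
      have closed: "val m \<otimes> h \<in> carrier G" using val_closed that(2) by simp
      have "eqv (code (val m \<otimes> h)) (code_append m (code h))"
      proof (rule eqv_codes)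
        show "list_decode (code_append m (code h)) \<in> lists K"
          using code(1)[OF that(2)] that(1) by (simp add: list_decode_append)
        show "val (code (val m \<otimes> h)) = val (code_append m (code h))"
          by (simp only: val_append code(2)[OF closed] code(2)[OF that(2)])
      qed (rule code(1)[OF closed])
      then show ?thesis using x_eqv closed by (simp add: z_def)
    qed
    have "z \<in> Z" unfolding Z_iff
    proof (intro conjI ballI, safe)
      show "z \<in> full_shift G B" using xB by (auto simp: z_def full_shift_def)
      fix F' p g assume D: "(F', p) \<in> P" and g: "g \<in> carrier G"
      show "\<exists>h\<in>F'. z (g \<otimes> h) \<noteq> p h"
      proof (rule ccontr)
        assume no: "\<not> ?thesis"
        have 1: "x (code_append (code g) (code h)) = p h" if "h \<in> F'" for h
        proof -
          have h: "h \<in> carrier G" using F(1)[OF D] that by blast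
          show ?thesis using no that z_mult[OF code(1)[OF g] h] code(2)[OF g] by auto
        qed
        \<comment> \<open>Large enough for the whole forbidden pattern to be inspected.\<close>
        define N where "N = Suc (\<Sum>h\<in>F'. code_append (code g) (code h))"
        have "code_append (code g) (code h) < N" if "h \<in> F'" for h
          using that F(2)[OF D] member_le_sum[of h F' "\<lambda>h. code_append (code g) (code h)"]
          by (simp add: N_def)
        then have "\<exists>D\<in>P. \<exists>m. \<forall>h\<in>fst D. code_append m (code h) < N \<and>
            x (code_append m (code h)) = snd D h"
          using 1 D by (intro bexI[of _ "(F', p)"] exI[of _ "code g"]) auto
        then show False using x[of N] unfolding conflict_def by blast
      qed
    qed
    moreover have "\<forall>h\<in>W. z h = q h"
    proof
      fix h assume h: "h \<in> W"
      then have "x (code h) = q h" using x[of "Suc (code h)"] unfolding conflict_def by blast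
      then show "z h = q h" using h W(2) by (auto simp: z_def)
    qed
    moreover have "\<forall>h\<in>W. z (val n \<otimes> h) = q h"
    proof
      fix h assume h: "h \<in> W"
      then have "x (code_append n (code h)) = q h"
        using x[of "Suc (code_append n (code h))"] unfolding conflict_def by blast
      then show "z (val n \<otimes> h) = q h" using h W(2) z_mult[OF n] by auto
    qed
    ultimately show False using sep val_closed nontriv by blast
  qed
qed

end

section \<open>Sofic covers solve the word problem\<close>

theorem corollary2p12:
  fixes G :: "('a, 'm) monoid_scheme" and S :: "'a set"
  assumes "group G"
    and "finite S" and "S \<subseteq> carrier G" and "generate G S = carrier G"
    and "\<one>\<^bsub>G\<^esub> \<in> S" and "\<And>s. s \<in> S \<Longrightarrow> inv\<^bsub>G\<^esub> s \<in> S"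
    and "recursively_presented G"
    and "\<not> decidable_language S (word_problem G S)"
  shows "\<not> sofic G {0, 1} (X_le1 G)"
proof
  assume sofic: "sofic G {0, 1} (X_le1 G)"
  interpret group G by fact
  obtain B :: "nat set" and Z W q where B: "finite B" and "SFT G B Z" and W: "finite W" "W \<subseteq> carrier G"
    and z0: "\<exists>z\<in>Z. \<forall>h\<in>W. z h = q h"
    and sep: "\<forall>z\<in>Z. \<forall>g\<in>carrier G. (\<forall>h\<in>W. z h = q h) \<longrightarrow> (\<forall>h\<in>W. z (g \<otimes>\<^bsub>G\<^esub> h) = q h) \<longrightarrow> g = \<one>\<^bsub>G\<^esub>"
    using sofic_X_le1_marker[OF sofic] by blast
  then obtain P where P: "finite P" "P \<subseteq> patterns G B" and
    Z: "Z = full_shift G B \<inter> (\<Inter>(F, p)\<in>P. \<Inter>g\<in>carrier G.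
        full_shift G B - (\<Inter>h\<in>F. cylinder G B (g \<otimes>\<^bsub>G\<^esub> h) (p h)))"
    unfolding SFT_def by blast
  obtain \<gamma> K eqv e where cg: "coded_group G \<gamma> K eqv" and e: "inj_on e S" "e ` S \<subseteq> K"
    "\<forall>s\<in>S. \<gamma> (e s) = s"
    using recursively_presented_coded_group[OF assms(1-3,7)] by blast
  interpret coded_group G \<gamma> K eqv by fact
  define M where "M = (\<lambda>w. list_encode (map e w)) ` word_problem G S"
  have val_e: "word_val G \<gamma> (map e w) = foldr (\<lambda>s t. s \<otimes>\<^bsub>G\<^esub> t) w \<one>\<^bsub>G\<^esub>" if "w \<in> lists S" for w
    using that e(3) by (induction w) (auto simp: word_val_def)
  have M: "m \<in> M \<longleftrightarrow> list_decode m \<in> lists (e ` S) \<and> val m = \<one>\<^bsub>G\<^esub>" for m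
  proof
    assume "m \<in> M"
    then obtain w where "w \<in> word_problem G S" "m = list_encode (map e w)"
      unfolding M_def by blast
    then show "list_decode m \<in> lists (e ` S) \<and> val m = \<one>\<^bsub>G\<^esub>"
      using val_e[of w] by (simp add: word_problem_def lists_image)
  next
    assume m: "list_decode m \<in> lists (e ` S) \<and> val m = \<one>\<^bsub>G\<^esub>"
    then obtain w where w: "w \<in> lists S" "list_decode m = map e w"
      unfolding lists_image by blast
    then have "m = list_encode (map e w)" by (metis list_decode_inverse)
    moreover have "w \<in> word_problem G S" using m w val_e by (simp add: word_problem_def)
    ultimately show "m \<in> M" unfolding M_def by blast
  qed
  have in_K: "list_decode m \<in> lists K" if "list_decode m \<in> lists (e ` S)" for m
    using that e(2) by auto
  have "m \<in> M \<longleftrightarrow> list_decode m \<in> lists (e ` S) \<and> eqv m 0" for m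
    using M[of m] in_K[of m] eqv_sound[of m 0] eqv_codes[of m 0] by (auto simp: word_val_def)
  then have "semidecidable (Suc 0) (\<lambda>xs. hd xs \<in> M)"
    by (simp only:) (intro semidecidable_conj semidecidable_in_lists semidecidable_eqv
      recursive_intros finite_imageI assms(2))
  moreover have "m \<notin> M \<longleftrightarrow> list_decode m \<notin> lists (e ` S) \<or> refuted B P W q m" for m
    using M[of m] in_K[of m] refuted_iff_nontrivial[OF B P Z W z0 sep, of m] by blast
  then have "semidecidable (Suc 0) (\<lambda>xs. hd xs \<notin> M)"
    by (simp only:) (intro semidecidable_disj semidecidable_not_in_lists semidecidable_refuted
      recursive_intros finite_imageI assms(2) B P W)
  ultimately have "decidable_set M" by (rule decidable_setI)
  then have "decidable_language S (word_problem G S)"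
    unfolding decidable_language_def M_def using e(1) by blast
  with assms(8) show False by blast
qed

end
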